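(* Let $k \ge 3$ be an integer and let $p_{2k-1}(x,y) = x^{k-1}y^{k-1}(x-y)$. Then $$L_{\mathbb{Q}(\zeta_{k+1})}(p_{2k-1}) = k, \qquad L_{\mathbb{Q}(\zeta_k)}(p_{2k-1}) = k+1, \qquad L_{\mathbb{R}}(p_{2k-1}) = 2k-1 > k+1.$$
   Context: $\zeta_m$ denotes a primitive $m$-th root of unity in $\mathbb{C}$ (e.g. $\zeta_m = e^{2\pi i/m}$). For a binary form (homogeneous polynomial) $f(x,y)$ of degree $d$ with coefficients in a field $K \subseteq \mathbb{C}$, the $K$-rank (or $K$-length) $L_K(f)$ is the smallest integer $r$ for which there is a representation $$f(x,y) = \sum_{j=1}^r \lambda_j(\alpha_j x + \beta_j y)^d$$ with $\lambda_j, \alpha_j, \beta_j \in K$ for all $j$. *)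

theory Defs
  imports
    "HOL-Algebra.Generated_Fields"
    "HOL-Algebra.Algebraic_Closure_Type"
    "HOL-Library.Extended_Nat"
    "HOL-Analysis.Analysis"
    "HOL-Computational_Algebra.Polynomial"
begin

text \<open>The ring of polynomials in \<open>x\<close> and \<open>y\<close> over the complex numbers is taken to be
  the polynomials in \<open>y\<close> over the ring of polynomials in \<open>x\<close>.\<close>

type_synonym bipoly = "complex poly poly"

definition bp_const :: "complex \<Rightarrow> bipoly"
  where "bp_const c = [:[:c:]:]"

definition bp_x :: bipoly
  where "bp_x = [:[:0, 1:]:]"

definition bp_y :: bipoly
  where "bp_y = [:0, 1:]"

definition has_power_sum_rep :: "complex set \<Rightarrow> nat \<Rightarrow> bipoly \<Rightarrow> nat \<Rightarrow> bool"
  where "has_power_sum_rep K d f r \<longleftrightarrow>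
    (\<exists>c \<alpha> \<beta> :: nat \<Rightarrow> complex.
       (\<forall>j\<in>{1..r}. c j \<in> K \<and> \<alpha> j \<in> K \<and> \<beta> j \<in> K) \<and>
       f = (\<Sum>j=1..r. bp_const (c j) * (bp_const (\<alpha> j) * bp_x + bp_const (\<beta> j) * bp_y) ^ d))"

text \<open>The value is \<open>\<infinity>\<close> if there is no representation at all, so that an equation
  \<open>form_length K d f = enat r\<close> includes the existence of a representation with \<open>r\<close> summands.
  The argument \<open>d\<close> is the degree of the form \<open>f\<close>.\<close>

definition form_length :: "complex set \<Rightarrow> nat \<Rightarrow> bipoly \<Rightarrow> enat"
  where "form_length K d f = (INF r\<in>{r. has_power_sum_rep K d f r}. enat r)"

definition primitive_root_of_unity :: "nat \<Rightarrow> complex \<Rightarrow> bool"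
  where "primitive_root_of_unity m z \<longleftrightarrow> m > 0 \<and> z ^ m = 1 \<and> (\<forall>j. 0 < j \<and> j < m \<longrightarrow> z ^ j \<noteq> 1)"

definition rat_adjoin :: "complex \<Rightarrow> complex set"
  where "rat_adjoin z = generate_field ring_of_type_algebra (insert z \<rat>)"

definition p_form :: "nat \<Rightarrow> bipoly"
  where "p_form k = bp_x ^ (k - 1) * bp_y ^ (k - 1) * (bp_x - bp_y)"

end

theory Submission
  imports Defs "Jordan_Normal_Form.Char_Poly"
begin

text \<open>Dividing out binomial coefficients turns \<open>x\<^sup>k\<^sup>-\<^sup>1y\<^sup>k\<^sup>-\<^sup>1(x - y)\<close> into the moment sequence with entries
  \<open>1, -1\<close> in the two middle positions (up to a scalar) and \<open>0\<close> elsewhere. By apolarity, the points of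
  a representation of length \<open>r\<close> are roots of a polynomial whose coefficients \<open>c\<^sub>i\<close> satisfy
  \<open>c\<^sub>k\<^sub>-\<^sub>1\<^sub>-\<^sub>l = c\<^sub>k\<^sub>-\<^sub>l\<close> for \<open>l \<le> 2k - 1 - r\<close>. For \<open>r < k\<close> this is impossible, and for \<open>r = k\<close> the polynomial
  is \<open>1 + t + \<dots> + t\<^sup>k\<close>, so that the field contains the \<open>(k + 1)\<close>-th roots of unity; the field generated by
  the \<open>k\<close>-th roots of unity does not. Over the reals, \<open>r \<le> 2k - 2\<close> gives three equal consecutive
  coefficients, which a polynomial with simple real roots cannot have by Rolle's theorem and Laguerre's
  inequality. The representations of length \<open>k\<close> and \<open>k + 1\<close> come from Fourier inversion on roots of
  unity, the real one from a palindromic polynomial with simple real roots.\<close>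

subsection \<open>Roots of unity of coprime orders\<close>

definition int_adjoin :: "complex \<Rightarrow> complex set"
  where "int_adjoin z = range (\<lambda>h. poly (map_poly of_int h) z)"

lemma int_adjoin_add: "u \<in> int_adjoin z \<Longrightarrow> v \<in> int_adjoin z \<Longrightarrow> u + v \<in> int_adjoin z"
  unfolding int_adjoin_def
  by (auto simp flip: poly_add of_int_poly_hom.hom_add)

lemma int_adjoin_mult: "u \<in> int_adjoin z \<Longrightarrow> v \<in> int_adjoin z \<Longrightarrow> u * v \<in> int_adjoin z"
  unfolding int_adjoin_def
  by (auto simp flip: poly_mult of_int_poly_hom.hom_mult)

lemma poly_of_int_poly_pCons:
  "poly (map_poly of_int (pCons a f)) (x :: complex) = of_int a + x * poly (map_poly of_int f) x"
  by (simp add: of_int_hom.map_poly_pCons_hom del: map_poly_pCons)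

lemma int_adjoin_of_int: "of_int a \<in> int_adjoin z"
proof -
  have "of_int a = poly (map_poly of_int [:a:]) z" unfolding poly_of_int_poly_pCons by simp
  then show ?thesis unfolding int_adjoin_def by blast
qed

lemma int_adjoin_self: "z \<in> int_adjoin z"
proof -
  have "z = poly (map_poly of_int [:0, 1:]) z" unfolding poly_of_int_poly_pCons by simp
  then show ?thesis unfolding int_adjoin_def by blast
qed

lemma int_adjoin_of_nat: "of_nat a \<in> int_adjoin z"
  using int_adjoin_of_int[of "int a"] by simp

lemma int_adjoin_0: "0 \<in> int_adjoin z" and int_adjoin_1: "1 \<in> int_adjoin z"
  using int_adjoin_of_int[of 0] int_adjoin_of_int[of 1] by simp_all

lemma int_adjoin_uminus: "u \<in> int_adjoin z \<Longrightarrow> - u \<in> int_adjoin z"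
  using int_adjoin_mult[OF int_adjoin_of_int[of "-1"]] by simp

lemma int_adjoin_diff: "u \<in> int_adjoin z \<Longrightarrow> v \<in> int_adjoin z \<Longrightarrow> u - v \<in> int_adjoin z"
  using int_adjoin_add[OF _ int_adjoin_uminus] by fastforce

lemma int_adjoin_power: "u \<in> int_adjoin z \<Longrightarrow> u ^ n \<in> int_adjoin z"
  by (induction n) (auto intro: int_adjoin_1 int_adjoin_mult)

lemma int_adjoin_sum: "(\<And>i. i \<in> I \<Longrightarrow> f i \<in> int_adjoin z) \<Longrightarrow> sum f I \<in> int_adjoin z"
  by (induction I rule: infinite_finite_induct) (auto intro: int_adjoin_0 int_adjoin_add)

lemma int_adjoin_poly:
  "x \<in> int_adjoin z \<Longrightarrow> poly (map_poly of_int h) x \<in> int_adjoin z"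
  by (induction h) (auto intro!: int_adjoin_0 int_adjoin_add int_adjoin_mult int_adjoin_of_int)

lemma root_of_unity_mod:
  fixes z :: complex
  assumes "z ^ n = 1"
  shows "z ^ (i mod n) = z ^ i"
proof -
  have "z ^ i = z ^ (n * (i div n) + i mod n)" by simp
  also have "\<dots> = z ^ (i mod n)" unfolding power_add power_mult assms by simp
  finally show ?thesis by simp
qed

section \<open>Integrality and divisibility in Z[z] for a root of unity z\<close>

text \<open>Multiplication by \<open>u\<close> acts on the vector \<open>1, z, ..., z^(n-1)\<close>
  through an integer matrix, because exponents wrap around modulo \<open>n\<close>. So
  \<open>u\<close> is an eigenvalue, hence a root of a monic integer characteristic polynomial. The
  powers may be linearly dependent; only their vector has to be nonzero.\<close>

lemma algebraic_int_int_adjoin: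
  assumes z: "z ^ n = 1" and n: "n > 0" and u: "u \<in> int_adjoin z"
  shows "algebraic_int u"
proof -
  obtain h where h: "u = poly (map_poly of_int h) z"
    using u unfolding int_adjoin_def by blast
  define d where "d = degree h"
  \<comment> \<open>Row \<open>i\<close> expands \<open>u * z^i\<close>: the coefficient of
    \<open>z^t\<close> in \<open>h\<close> goes to column \<open>(t + i) mod n\<close>.\<close>
  define A :: "int mat" where
    "A = mat n n (\<lambda>(i, j). \<Sum>t | t \<le> d \<and> (t + i) mod n = j. coeff h t)"
  define B :: "complex mat" where "B = map_mat of_int A"
  define v where "v = vec n (\<lambda>i. z ^ i)"
  have A: "A \<in> carrier_mat n n" and B: "B \<in> carrier_mat n n" and v: "v \<in> carrier_vec n"
    by (auto simp: A_def B_def v_def)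
  have u_sum: "u = (\<Sum>t\<le>d. of_int (coeff h t) * z ^ t)"
    unfolding h poly_altdef d_def by (simp add: degree_map_poly coeff_map_poly)
  have "B *\<^sub>v v = u \<cdot>\<^sub>v v"
  proof (rule eq_vecI)
    fix i assume "i < dim_vec (u \<cdot>\<^sub>v v)"
    then have i: "i < n" by (simp add: v_def)
    have "vec_index (B *\<^sub>v v) i = (\<Sum>j<n. (\<Sum>t | t \<le> d \<and> (t + i) mod n = j. of_int (coeff h t)) * z ^ j)"
      using i B by (simp add: scalar_prod_def B_def A_def v_def atLeast0LessThan)
    also have "\<dots> = (\<Sum>j<n. \<Sum>t | t \<in> {..d} \<and> (t + i) mod n = j. of_int (coeff h t) * z ^ (t + i))"
      using root_of_unity_mod[OF z] by (auto simp: sum_distrib_right intro!: sum.cong)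
    also have "\<dots> = (\<Sum>t\<le>d. of_int (coeff h t) * z ^ (t + i))"
      by (rule sum.group) (use n in auto)
    also have "\<dots> = u * z ^ i"
      unfolding u_sum by (simp add: sum_distrib_right power_add mult.assoc)
    finally show "vec_index (B *\<^sub>v v) i = vec_index (u \<cdot>\<^sub>v v) i" using i by (simp add: v_def)
  qed (simp add: B_def A_def v_def)
  moreover have "v \<noteq> 0\<^sub>v n"
  proof
    assume "v = 0\<^sub>v n"
    then have "vec_index v 0 = 0" using n by simp
    then show False using n by (simp add: v_def)
  qed
  ultimately have "eigenvalue B u"
    using B v unfolding eigenvalue_def eigenvector_def by auto
  then have "poly (char_poly B) u = 0"
    using eigenvalue_root_char_poly[OF B] by simp
  then have "poly (map_poly of_int (char_poly A)) u = 0"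
    unfolding B_def of_int_hom.char_poly_hom[OF A] .
  moreover have "lead_coeff (char_poly A) = 1"
    using degree_monic_char_poly[OF A] by simp
  ultimately show ?thesis
    unfolding algebraic_int_altdef_ipoly by blast
qed

lemma poly_nonzero_const_coeff:
  fixes q :: "int poly" and b :: complex
  assumes "b \<noteq> 0" "q \<noteq> 0" "poly (map_poly of_int q) b = 0"
  shows "\<exists>a q'. a \<noteq> 0 \<and> poly (map_poly of_int (pCons a q')) b = 0"
  using assms(2,3)
proof (induction q)
  case (pCons a q)
  show ?case
  proof (cases "a = 0")
    case True
    then have "q \<noteq> 0" "poly (map_poly of_int q) b = 0"
      using pCons assms(1) by auto
    then show ?thesis using pCons.IH by blast
  qed (use pCons in blast)
qed simp

text \<open>A substitute for the norm: after cancelling powers of the variable, an integer equation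
  for \<open>b\<close> reads \<open>a + b * q'(b) = 0\<close> with \<open>a \<noteq> 0\<close>, and
  \<open>q'(b)\<close> is the cofactor.\<close>

lemma int_adjoin_multiple_in_Ints:
  assumes "z ^ n = 1" "n > 0" "b \<in> int_adjoin z" "b \<noteq> 0"
  shows "\<exists>a::int. \<exists>c\<in>int_adjoin z. a \<noteq> 0 \<and> b * c = of_int a"
proof -
  obtain q where q: "poly (map_poly of_int q) b = 0" "lead_coeff q = 1"
    using algebraic_int_int_adjoin[OF assms(1-3)] unfolding algebraic_int_altdef_ipoly by blast
  then have "q \<noteq> 0" by auto
  from poly_nonzero_const_coeff[OF assms(4) this q(1)] obtain a q'
    where a: "a \<noteq> 0" "poly (map_poly of_int (pCons a q')) b = 0" by blast
  then have "b * poly (map_poly of_int q') b = of_int (- a)"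
    by (simp add: add_eq_0_iff)
  moreover have "poly (map_poly of_int q') b \<in> int_adjoin z"
    by (rule int_adjoin_poly[OF assms(3)])
  ultimately show ?thesis using a(1) by (metis neg_equal_0_iff_equal)
qed

text \<open>If \<open>b * c = a\<close> is a nonzero integer and \<open>b = p * e\<close>, then
  \<open>e * c = a / p\<close> is a rational algebraic integer, so \<open>p\<close> divides
  \<open>a\<close>. Hence \<open>|a|\<close> serves as \<open>N\<close>.\<close>

lemma int_adjoin_prime_divisors:
  assumes "z ^ n = 1" "n > 0" "b \<in> int_adjoin z" "b \<noteq> 0"
  shows "\<exists>N::nat. N > 0 \<and> (\<forall>p. p > 0 \<longrightarrow> (\<exists>c\<in>int_adjoin z. b = of_nat p * c) \<longrightarrow> p dvd N)"
proof -
  obtain a :: int and c where c: "c \<in> int_adjoin z" and a: "a \<noteq> 0" "b * c = of_int a"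
    using int_adjoin_multiple_in_Ints[OF assms] by blast
  have "p dvd nat \<bar>a\<bar>" if p: "p > 0" "e \<in> int_adjoin z" "b = of_nat p * e" for p e
  proof -
    have eq: "e * c = of_int a / of_nat p" using a p by (simp add: field_simps)
    have "algebraic_int (e * c)"
      by (rule algebraic_int_int_adjoin[OF assms(1,2) int_adjoin_mult[OF p(2) c]])
    moreover have "e * c \<in> \<rat>" unfolding eq by simp
    ultimately have "e * c \<in> \<int>" by (rule rational_algebraic_int_is_int)
    then obtain m where "e * c = of_int m" by (elim Ints_cases)
    then have "of_int a = (of_int (int p * m) :: complex)" using eq p(1) by (simp add: field_simps)
    then have "a = int p * m" by (simp only: of_int_eq_iff)
    then show ?thesis by (simp add: nat_dvd_iff abs_mult nat_mult_distrib)
  qed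
  then show ?thesis using a(1) by (intro exI[of _ "nat \<bar>a\<bar>"]) auto
qed

section \<open>Frobenius congruences modulo p in Z[z]\<close>

lemma int_adjoin_freshman:
  assumes p: "prime p" and u: "u \<in> int_adjoin z" and v: "v \<in> int_adjoin z"
  shows "\<exists>w\<in>int_adjoin z. (u + v) ^ p = u ^ p + v ^ p + of_nat p * w"
proof -
  let ?f = "\<lambda>i. of_nat (p choose i) * u ^ i * v ^ (p - i)"
  define w where "w = (\<Sum>i\<in>{1..<p}. of_nat ((p choose i) div p) * u ^ i * v ^ (p - i))"
  have p1: "p > 1" using p by (rule prime_gt_1_nat)
  have "{..p} = insert 0 (insert p {1..<p})" using p1 by auto
  then have "(u + v) ^ p = u ^ p + v ^ p + (\<Sum>i\<in>{1..<p}. ?f i)"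
    unfolding binomial_ring using p1 by simp
  also have "(\<Sum>i\<in>{1..<p}. ?f i) = of_nat p * w"
    unfolding w_def sum_distrib_left
  proof (rule sum.cong)
    fix i assume i: "i \<in> {1..<p}"
    then have "p dvd (p choose i)" using p by (intro dvd_choose_prime) auto
    then have "of_nat (p choose i) = (of_nat p * of_nat ((p choose i) div p) :: complex)"
      by (metis dvd_mult_div_cancel of_nat_mult)
    then show "?f i = of_nat p * (of_nat ((p choose i) div p) * u ^ i * v ^ (p - i))" by simp
  qed simp
  finally show ?thesis
    by (rule bexI)
      (auto simp: w_def intro!: int_adjoin_sum int_adjoin_mult int_adjoin_power int_adjoin_of_nat u v)
qed

text \<open>Fermat's little theorem from the binomial congruence for \<open>b + 1\<close>, by
  induction in both directions from 0 so that negative integers are covered.\<close>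

lemma int_adjoin_fermat:
  assumes p: "prime p"
  shows "\<exists>w\<in>int_adjoin z. of_int a ^ p = of_int a + of_nat p * w"
proof -
  have step: "\<exists>w\<in>int_adjoin z. of_int (b + 1) ^ p = of_int b ^ p + 1 + of_nat p * w" for b
    using int_adjoin_freshman[OF p int_adjoin_of_int[of b z] int_adjoin_1] by simp
  show ?thesis
  proof (induction a rule: int_induct[where k = 0])
    case base
    have "p > 0" using p by (rule prime_gt_0_nat)
    then show ?case by (auto simp: int_adjoin_0 intro!: bexI[of _ 0])
  next
    case (step1 b)
    then obtain w where w: "w \<in> int_adjoin z" "of_int b ^ p = of_int b + of_nat p * w" by blast
    obtain w' where w': "w' \<in> int_adjoin z" "of_int (b + 1) ^ p = of_int b ^ p + 1 + of_nat p * w'"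
      using step by blast
    show ?case
      by (rule bexI[of _ "w + w'"]) (use w w' in \<open>auto simp: algebra_simps intro: int_adjoin_add\<close>)
  next
    case (step2 b)
    then obtain w where w: "w \<in> int_adjoin z" "of_int b ^ p = of_int b + of_nat p * w" by blast
    obtain w' where w': "w' \<in> int_adjoin z" "of_int b ^ p = of_int (b - 1) ^ p + 1 + of_nat p * w'"
      using step[of "b - 1"] by auto
    have "of_int (b - 1) ^ p = of_int (b - 1) + of_nat p * (w - w')"
      using w(2) w'(2) by (simp add: algebra_simps)
    then show ?case
      by (rule bexI) (use w w' in \<open>auto intro: int_adjoin_diff\<close>)
  qed
qed

text \<open>Horner induction on \<open>f\<close>: the binomial congruence splits off the constant
  term, and Fermat replaces its \<open>p\<close>-th power by the term itself.\<close>

lemma int_adjoin_frobenius: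
  assumes p: "prime p" and x: "x \<in> int_adjoin z"
  shows "\<exists>w\<in>int_adjoin z.
    poly (map_poly of_int f) (x ^ p) = poly (map_poly of_int f) x ^ p + of_nat p * w"
proof (induction f)
  case 0
  have "p > 0" using p by (rule prime_gt_0_nat)
  then show ?case by (auto simp: int_adjoin_0 intro!: bexI[of _ 0])
next
  case (pCons a f)
  let ?F = "\<lambda>x. poly (map_poly of_int f) x" and ?F' = "\<lambda>x. poly (map_poly of_int (pCons a f)) x"
  obtain w where w: "w \<in> int_adjoin z" "?F (x ^ p) = ?F x ^ p + of_nat p * w"
    using pCons.IH by blast
  obtain e where e: "e \<in> int_adjoin z" "of_int a ^ p = of_int a + of_nat p * e"
    using int_adjoin_fermat[OF p] by blast
  have "x * ?F x \<in> int_adjoin z" by (intro int_adjoin_mult x int_adjoin_poly)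
  from int_adjoin_freshman[OF p int_adjoin_of_int[of a] this] obtain g
    where g: "g \<in> int_adjoin z"
      "(of_int a + x * ?F x) ^ p = of_int a ^ p + (x * ?F x) ^ p + of_nat p * g" by blast
  have "of_int a + x ^ p * ?F (x ^ p)
      = (of_int a + x * ?F x) ^ p + of_nat p * (x ^ p * w - e - g)"
    unfolding w(2) g(2) e(2) by (simp add: algebra_simps power_mult_distrib)
  moreover have "x ^ p * w - e - g \<in> int_adjoin z"
    by (intro int_adjoin_diff int_adjoin_mult int_adjoin_power x w(1) e(1) g(1))
  moreover have "?F' y = of_int a + y * ?F y" for y :: complex
    by (rule poly_of_int_poly_pCons)
  ultimately show ?case by (intro bexI[of _ "x ^ p * w - e - g"]) simp_all
qed

text \<open>If \<open>f(z\<^sup>i) = 0\<close> then \<open>f(z\<^sup>i\<^sup>p)\<close> is divisible by \<open>p\<close>; a nonzero element of \<open>\<int>[z]\<close> has only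
  finitely many prime divisors, so \<open>f(z\<^sup>i\<^sup>p) = 0\<close> for almost all \<open>p\<close>. This avoids the irreducibility
  of the cyclotomic polynomials.\<close>

lemma root_of_unity_conjugate_root:
  fixes f :: "int poly" and z :: complex
  assumes z: "z ^ n = 1" and n: "n > 0"
  shows "\<exists>N::nat. N > 0 \<and> (\<forall>j>0. coprime j N \<longrightarrow>
    (\<forall>i. poly (map_poly of_int f) (z ^ i) = 0 \<longrightarrow> poly (map_poly of_int f) (z ^ (i * j)) = 0))"
proof -
  let ?F = "\<lambda>x. poly (map_poly of_int f) x"
  have F_in: "?F (z ^ i) \<in> int_adjoin z" for i
    by (intro int_adjoin_poly int_adjoin_power int_adjoin_self)
  have "\<forall>i. \<exists>N::nat. N > 0 \<and> (?F (z ^ i) \<noteq> 0 \<longrightarrow>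
      (\<forall>p. p > 0 \<longrightarrow> (\<exists>c\<in>int_adjoin z. ?F (z ^ i) = of_nat p * c) \<longrightarrow> p dvd N))"
  proof
    fix i
    show "\<exists>N::nat. N > 0 \<and> (?F (z ^ i) \<noteq> 0 \<longrightarrow>
      (\<forall>p. p > 0 \<longrightarrow> (\<exists>c\<in>int_adjoin z. ?F (z ^ i) = of_nat p * c) \<longrightarrow> p dvd N))"
      using int_adjoin_prime_divisors[OF z n F_in, of i] by (cases "?F (z ^ i) = 0") auto
  qed
  then obtain N :: "nat \<Rightarrow> nat" where N: "\<And>i. N i > 0"
    "\<And>i p c. ?F (z ^ i) \<noteq> 0 \<Longrightarrow> p > 0 \<Longrightarrow> c \<in> int_adjoin z \<Longrightarrow> ?F (z ^ i) = of_nat p * c \<Longrightarrow> p dvd N i"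
    by metis
  \<comment> \<open>Powers of \<open>z\<close> depend only on the exponent modulo \<open>n\<close>,
    so a product of \<open>n\<close> bounds serves all exponents.\<close>
  define M where "M = prod N {..<n}"
  have M: "M > 0" unfolding M_def by (simp add: N)
  have prime_step: "?F (z ^ (i * p)) = 0" if p: "prime p" "\<not> p dvd M" and i: "?F (z ^ i) = 0" for p i
  proof (rule ccontr)
    assume nz: "?F (z ^ (i * p)) \<noteq> 0"
    have p0: "p > 0" using p(1) by (rule prime_gt_0_nat)
    obtain w where w: "w \<in> int_adjoin z" "?F ((z ^ i) ^ p) = ?F (z ^ i) ^ p + of_nat p * w"
      using int_adjoin_frobenius[OF p(1) int_adjoin_power[OF int_adjoin_self]] by blast
    define j where "j = i * p mod n"
    have zj: "z ^ j = z ^ (i * p)" unfolding j_def by (rule root_of_unity_mod[OF z])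
    have "?F (z ^ j) = of_nat p * w"
      using w(2) i p0 unfolding zj by (simp add: power_mult)
    then have "p dvd N j" using N(2)[of j p w] nz p0 w(1) unfolding zj by blast
    moreover have "N j dvd M" unfolding M_def by (rule dvd_prodI) (use n in \<open>auto simp: j_def\<close>)
    ultimately show False using p(2) dvd_trans by blast
  qed
  \<comment> \<open>An exponent coprime to \<open>M\<close> is reached one prime factor at a time,
    and none of these primes divides \<open>M\<close>.\<close>
  have "?F (z ^ (i * j)) = 0" if "j > 0" "coprime j M" "?F (z ^ i) = 0" for i j
    using that
  proof (induction j arbitrary: i rule: prime_divisors_induct)
    case zero
    then show ?case by simp
  next
    case (unit x)
    then show ?case by simp
  next
    case (factor p x)
    have "\<not> p dvd M"
      using factor(1,4) by (metis coprime_absorb_left coprime_mult_left_iff not_prime_unit)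
    then have "?F (z ^ (i * p)) = 0" using prime_step factor by blast
    then have "?F (z ^ (i * p * x)) = 0" using factor by (simp add: coprime_mult_left_iff)
    then show ?case by (simp add: mult.assoc)
  qed
  then show ?thesis using M by blast
qed

section \<open>Denominators in Q(z) and separation of the two cyclotomic fields\<close>

text \<open>Only inversion needs work: if \<open>M * h * c = a\<close> is a nonzero integer with
  \<open>c\<close> in Z[z], then \<open>a * inverse h = M * c\<close>.\<close>

lemma rat_adjoin_subset:
  assumes z: "z ^ n = 1" and n: "n > 0" and u: "u \<in> rat_adjoin z"
  shows "\<exists>M::int. M \<noteq> 0 \<and> of_int M * u \<in> int_adjoin z"
proof -
  interpret R: field "ring_of_type_algebra :: complex ring"
    by (rule field_from_type_algebra)
  show ?thesis
    using u unfolding rat_adjoin_def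
  proof (induction rule: generate_field.induct)
    case one
    then show ?case
      by (intro exI[of _ 1]) (simp add: ring_of_type_algebra_def int_adjoin_1)
  next
    case (incl h)
    show ?case
    proof (cases "h = z")
      case True
      then show ?thesis by (intro exI[of _ 1]) (simp add: int_adjoin_self)
    next
      case False
      then have "h \<in> \<rat>" using incl by simp
      then obtain a b :: int where "b \<noteq> 0" "h = of_int a / of_int b"
        by (metis Rats_cases' less_irrefl)
      then show ?thesis
        using int_adjoin_of_int by (intro exI[of _ b]) simp
    qed
  next
    case (a_inv h)
    then obtain M :: int where M: "M \<noteq> 0" "of_int M * h \<in> int_adjoin z" by blast
    have "\<ominus>\<^bsub>ring_of_type_algebra\<^esub> h = - h"
      by (rule R.minus_equality) (simp_all add: ring_of_type_algebra_def)
    then show ?case using M int_adjoin_uminus[OF M(2)] by auto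
  next
    case (m_inv h)
    then obtain M :: int where M: "M \<noteq> 0" "of_int M * h \<in> int_adjoin z" by blast
    have h: "h \<noteq> 0" using m_inv by (simp add: ring_of_type_algebra_def)
    have inv: "inv\<^bsub>ring_of_type_algebra\<^esub> h = inverse h"
      by (rule R.comm_inv_char) (use h in \<open>simp_all add: ring_of_type_algebra_def\<close>)
    obtain a :: int and c where c: "c \<in> int_adjoin z" and a: "a \<noteq> 0" "of_int M * h * c = of_int a"
      using int_adjoin_multiple_in_Ints[OF z n M(2)] M(1) h by auto
    have "of_int a * inverse h = of_int M * c"
      unfolding a(2)[symmetric] using h by simp
    then show ?case
      unfolding inv using a(1) int_adjoin_mult[OF int_adjoin_of_int c] by metis
  next
    case (eng_add h1 h2)
    then obtain M1 M2 :: int where M: "M1 \<noteq> 0" "of_int M1 * h1 \<in> int_adjoin z"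
      "M2 \<noteq> 0" "of_int M2 * h2 \<in> int_adjoin z" by blast
    have "of_int (M1 * M2) * (h1 + h2)
        = of_int M2 * (of_int M1 * h1) + of_int M1 * (of_int M2 * h2)"
      by (simp add: algebra_simps)
    also have "\<dots> \<in> int_adjoin z"
      by (intro int_adjoin_add int_adjoin_mult[OF int_adjoin_of_int] M)
    finally show ?case using M
      by (intro exI[of _ "M1 * M2"]) (simp add: ring_of_type_algebra_def)
  next
    case (eng_mult h1 h2)
    then obtain M1 M2 :: int where M: "M1 \<noteq> 0" "of_int M1 * h1 \<in> int_adjoin z"
      "M2 \<noteq> 0" "of_int M2 * h2 \<in> int_adjoin z" by blast
    have "of_int (M1 * M2) * (h1 * h2) = (of_int M1 * h1) * (of_int M2 * h2)"
      by (simp add: algebra_simps)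
    also have "\<dots> \<in> int_adjoin z" by (intro int_adjoin_mult M)
    finally show ?case using M
      by (intro exI[of _ "M1 * M2"]) (simp add: ring_of_type_algebra_def)
  qed
qed

text \<open>An elementary replacement for Dirichlet's theorem: with \<open>t\<close> the product of
  the primes of \<open>N\<close> not dividing \<open>a\<close>, every prime of \<open>N\<close>
  divides exactly one of \<open>a\<close> and \<open>m * t\<close>, hence not their sum.\<close>

lemma coprime_in_progression:
  fixes a m N :: nat
  assumes "coprime a m" "N > 0"
  shows "\<exists>t. coprime (a + m * t) N"
proof -
  define t where "t = \<Prod>{q \<in> prime_factors N. \<not> q dvd a}"
  have "coprime (a + m * t) N"
  proof (rule ccontr)
    assume "\<not> coprime (a + m * t) N"
    then obtain c where c: "c dvd a + m * t" "c dvd N" "c \<noteq> 1"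
      by (elim not_coprimeE) simp
    then obtain q where "prime q" "q dvd c" using prime_factor_nat by blast
    then have q: "prime q" "q dvd a + m * t" "q dvd N" using c dvd_trans by blast+
    have qN: "q \<in> prime_factors N" using q assms(2) by (simp add: prime_factors_dvd)
    show False
    proof (cases "q dvd a")
      case True
      then have "q dvd m * t" using q(2) by (simp add: dvd_add_right_iff)
      then consider "q dvd m" | "q dvd t" using q(1) prime_dvd_mult_iff by blast
      then show False
      proof cases
        case 1
        then show False using True assms(1) q(1) by (meson coprime_common_divisor not_prime_unit)
      next
        case 2
        then obtain r where "r \<in> prime_factors N" "\<not> r dvd a" "q dvd r"
          unfolding t_def using q(1) by (subst (asm) prime_dvd_prod_iff) auto
        moreover have "prime r" using calculation(1) by auto
        ultimately show False using True q(1) primes_dvd_imp_eq by blast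
      qed
    next
      case False
      then have "q dvd t" unfolding t_def using qN by (intro dvd_prodI[of _ _ "\<lambda>x. x", simplified]) auto
      then show False using q(2) False by (simp add: dvd_add_left_iff)
    qed
  qed
  then show ?thesis by blast
qed

text \<open>Otherwise the conjugation that fixes \<open>a\<close> and inverts \<open>b\<close> would
  also fix \<open>b\<close>, a rational polynomial in \<open>a\<close>; then \<open>b^2 = 1\<close>,
  against the order \<open>k + 1 \<ge> 3\<close>. On \<open>w = a * b\<close>, which has both
  \<open>a\<close> and \<open>b\<close> as powers, this conjugation raises to a power
  \<open>j\<close> congruent to 1 modulo \<open>k\<close> and to -1 modulo
  \<open>k + 1\<close>.\<close>

lemma primitive_root_not_in_rat_adjoin:
  assumes k: "k \<ge> 2" and a: "a ^ k = 1" and b: "primitive_root_of_unity (k + 1) b"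
  shows "b \<notin> rat_adjoin a"
proof
  assume "b \<in> rat_adjoin a"
  then obtain M :: int where M: "M \<noteq> 0" "of_int M * b \<in> int_adjoin a"
    using rat_adjoin_subset[OF a] k by auto
  then obtain G where G: "of_int M * b = poly (map_poly of_int G) a"
    unfolding int_adjoin_def by blast
  have b1: "b ^ (k + 1) = 1" and b2: "b ^ 2 \<noteq> 1"
    using b k unfolding primitive_root_of_unity_def by auto
  define w where "w = a * b"
  define n where "n = k * (k + 1)"
  \<comment> \<open>The relation \<open>M * b = G(a)\<close> as an integer polynomial vanishing at
    \<open>w\<close>, since \<open>w^(k * k) = b\<close> and \<open>w^(k + 1) = a\<close>.\<close>
  define f where "f = monom M (k * k) - pcompose G (monom 1 (k + 1))"
  have f: "poly (map_poly of_int f) x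
      = of_int M * x ^ (k * k) - poly (map_poly of_int G) (x ^ (k + 1))" for x :: complex
    unfolding f_def by (simp add: of_int_poly_hom.hom_minus of_int_hom.map_poly_pcompose poly_pcompose poly_monom)
  have "a ^ n = 1" unfolding n_def power_mult a by simp
  moreover have "b ^ n = 1" unfolding n_def mult.commute[of k] power_mult b1 by simp
  ultimately have wn: "w ^ n = 1" unfolding w_def power_mult_distrib by simp
  have bk: "b * b ^ k = 1" using b1 by simp
  have wk: "w ^ (k * k) = b"
  proof -
    have "w ^ (k * k) = (b ^ k) ^ k" 
      unfolding w_def power_mult_distrib power_mult using a by simp
    also have "\<dots> = b"
    proof -
      have "b ^ k = inverse b" using bk by (metis inverse_unique)
      then show ?thesis using bk by (metis inverse_inverse_eq power_inverse)
    qed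
    finally show ?thesis .
  qed
  have wk1: "w ^ (k + 1) = a"
    unfolding w_def power_mult_distrib b1 using a by simp
  have "poly (map_poly of_int f) (w ^ 1) = 0"
    unfolding f by (simp only: power_one_right wk wk1 G) simp
  moreover obtain N where N: "N > 0"
    "\<And>j i. j > 0 \<Longrightarrow> coprime j N \<Longrightarrow> poly (map_poly of_int f) (w ^ i) = 0
       \<Longrightarrow> poly (map_poly of_int f) (w ^ (i * j)) = 0"
    using root_of_unity_conjugate_root[OF wn, of f] k unfolding n_def by auto
  moreover have "coprime (2 * k + 1) n"
  proof -
    have "coprime (2 * k + 1) k"
    proof (rule coprimeI)
      fix c assume c: "c dvd 2 * k + 1" "c dvd k"
      then have "c dvd 2 * k" by simp
      then show "is_unit c" using c(1) dvd_add_right_iff by blast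
    qed
    moreover have "coprime (2 * k + 1) (k + 1)"
    proof (rule coprimeI)
      fix c assume c: "c dvd 2 * k + 1" "c dvd k + 1"
      then have "c dvd (2 * k + 1) + 1" using dvd_mult[OF c(2), of 2] by simp
      then show "is_unit c" using c(1) dvd_add_right_iff by blast
    qed
    ultimately show ?thesis unfolding n_def by (simp only: coprime_mult_right_iff)
  qed
  \<comment> \<open>The residue \<open>2 * k + 1\<close> is 1 modulo \<open>k\<close> and -1 modulo
    \<open>k + 1\<close>. Adding multiples of \<open>n\<close> leaves the power of \<open>w\<close>
    unchanged and makes the exponent coprime to \<open>N\<close>.\<close>
  then obtain t where "coprime (2 * k + 1 + n * t) N"
    using coprime_in_progression N(1) by blast
  moreover define j where "j = 2 * k + 1 + n * t"
  ultimately have "poly (map_poly of_int f) (w ^ j) = 0"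
    using N(2)[of j 1] by simp
  then have "of_int M * (w ^ (k * k)) ^ j = poly (map_poly of_int G) ((w ^ (k + 1)) ^ j)"
  proof -
    have "(w ^ j) ^ m = (w ^ m) ^ j" for m by (simp only: power_mult[symmetric] mult.commute)
    then show ?thesis
      using \<open>poly (map_poly of_int f) (w ^ j) = 0\<close> unfolding f by (simp only: right_minus_eq)
  qed
  then have eq: "of_int M * b ^ j = poly (map_poly of_int G) (a ^ j)"
    unfolding wk wk1 .
  have "a ^ j = a"
  proof -
    have "j = k * (2 + (k + 1) * t) + 1" unfolding j_def n_def by (simp add: algebra_simps)
    then show ?thesis by (simp add: power_add power_mult a)
  qed
  moreover have "b * b ^ j = 1"
  proof -
    have "Suc j = (k + 1) * (2 + k * t)" unfolding j_def n_def by (simp add: algebra_simps)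
    then have "b ^ Suc j = 1" by (simp only: power_mult b1 power_one)
    then show ?thesis by simp
  qed
  moreover have "b ^ j = b"
    using eq G M(1) \<open>a ^ j = a\<close> by (metis mult_left_cancel of_int_eq_0_iff)
  ultimately have "b * b = 1" by simp
  then show False using b2 by (simp add: power2_eq_square)
qed

subsection \<open>Power sum representations and moments\<close>

lemma power_linear_form:
  "(bp_const \<alpha> * bp_x + bp_const \<beta> * bp_y) ^ d
    = (\<Sum>i\<le>d. monom (monom (of_nat (d choose i) * \<alpha> ^ (d - i) * \<beta> ^ i) (d - i)) i)"
proof -
  have "bp_const \<alpha> * bp_x = monom (monom \<alpha> 1) 0" "bp_const \<beta> * bp_y = monom (monom \<beta> 0) 1"
    by (simp_all add: bp_const_def bp_x_def bp_y_def monom_altdef)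
  then have "(bp_const \<alpha> * bp_x + bp_const \<beta> * bp_y) ^ d
      = (monom (monom \<beta> 0) 1 + monom (monom \<alpha> 1) 0) ^ d"
    by (simp add: add.commute)
  also have "\<dots> = (\<Sum>i\<le>d. monom (monom (of_nat (d choose i) * \<alpha> ^ (d - i) * \<beta> ^ i) (d - i)) i)"
    unfolding binomial_ring
    by (intro sum.cong) (simp_all add: monom_power mult_monom of_nat_monom mult_ac)
  finally show ?thesis .
qed

lemma p_form_monom:
  assumes "k \<ge> 1"
  shows "p_form k = monom (monom 1 k) (k - 1) - monom (monom 1 (k - 1)) k"
proof -
  have x: "bp_x = monom (monom 1 1) 0" and y: "bp_y = monom (monom 1 0) 1"
    by (simp_all add: bp_x_def bp_y_def monom_altdef)
  show ?thesis
    unfolding p_form_def x y using assms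
    by (simp add: monom_power mult_monom algebra_simps)
qed

text \<open>The coefficients of \<open>p_form k\<close> in the basis \<open>binomial (2k - 1) i * x\<^sup>2\<^sup>k\<^sup>-\<^sup>1\<^sup>-\<^sup>i y\<^sup>i\<close>.\<close>

definition p_moment :: "nat \<Rightarrow> nat \<Rightarrow> 'a::field_char_0"
  where "p_moment k i = (of_bool (i + 1 = k) - of_bool (i = k)) / of_nat ((2 * k - 1) choose k)"

text \<open>Coefficientwise both sides carry the factor \<open>d choose i\<close>, which is nonzero
  and cancels.\<close>

lemma has_power_sum_rep_p_form_iff:
  assumes k: "k \<ge> 1" and d: "d = 2 * k - 1"
  shows "has_power_sum_rep K d (p_form k) r \<longleftrightarrow>
    (\<exists>c \<alpha> \<beta>. (\<forall>j\<in>{1..r}. c j \<in> K \<and> \<alpha> j \<in> K \<and> \<beta> j \<in> K) \<and>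
      (\<forall>i\<le>d. (\<Sum>j=1..r. c j * \<alpha> j ^ (d - i) * \<beta> j ^ i) = p_moment k i))"
proof -
  have "p_form k = (\<Sum>j=1..r. bp_const (c j) * (bp_const (\<alpha> j) * bp_x + bp_const (\<beta> j) * bp_y) ^ d)
    \<longleftrightarrow> (\<forall>i\<le>d. (\<Sum>j=1..r. c j * \<alpha> j ^ (d - i) * \<beta> j ^ i) = p_moment k i)"
    (is "p_form k = ?F \<longleftrightarrow> ?R") for c \<alpha> \<beta>
  proof -
    let ?S = "\<lambda>i. \<Sum>j=1..r. c j * \<alpha> j ^ (d - i) * \<beta> j ^ i"
    have "?F = (\<Sum>i\<le>d. monom (monom (of_nat (d choose i) * ?S i) (d - i)) i)"
    proof -
      have const: "bp_const a = monom (monom a 0) 0" for a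
        by (simp add: bp_const_def monom_altdef)
      have "?F = (\<Sum>j=1..r. \<Sum>i\<le>d. monom (monom (of_nat (d choose i) * (c j * \<alpha> j ^ (d - i) * \<beta> j ^ i)) (d - i)) i)"
        unfolding power_linear_form sum_distrib_left
        by (intro sum.cong) (simp_all add: const mult_monom mult_ac)
      also have "\<dots> = (\<Sum>i\<le>d. monom (monom (of_nat (d choose i) * ?S i) (d - i)) i)"
        by (subst sum.swap) (simp add: monom_sum sum_distrib_left)
      finally show ?thesis .
    qed
    then have "coeff ?F i = (if i \<le> d then monom (of_nat (d choose i) * ?S i) (d - i) else 0)" for i
      by (simp add: coeff_sum)
    then have F: "coeff (coeff ?F i) m = (if i + m = d then of_nat (d choose i) * ?S i else 0)" for i m
      by (simp only: coeff_monom if_distrib[of "\<lambda>p. coeff p m"] coeff_0) auto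
    have P: "coeff (coeff (p_form k) i) m = (if i + m = d then of_nat (d choose i) * p_moment k i else 0)" for i m
    proof -
      \<comment> \<open>The two middle binomials coincide, which is why \<open>p_moment\<close> has
        a single denominator.\<close>
      have "2 * k - 1 - (k - 1) = k" using k by simp
      then have sym: "(d choose (k - 1)) = (d choose k)"
        unfolding d using binomial_symmetric[of "k - 1" "2 * k - 1"] by simp
      have pos: "of_nat (d choose k) \<noteq> (0 :: complex)" unfolding d using k by simp
      have "coeff (coeff (p_form k) i) m = of_bool (i = k - 1 \<and> m = k) - of_bool (i = k \<and> m = k - 1)"
        unfolding p_form_monom[OF k] by simp
      also have "\<dots> = (if i + m = d then of_nat (d choose i) * p_moment k i else 0)"
      proof -
        consider "i = k - 1" | "i = k" | "i \<noteq> k - 1" "i \<noteq> k" by blast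
        then show ?thesis
        proof cases
          case 1
          moreover have "(k - 1 + m = d) = (m = k)" "k - 1 \<noteq> k" "k - 1 + 1 = k" using k d by auto
          ultimately show ?thesis using sym pos unfolding p_moment_def d[symmetric] by simp
        next
          case 2
          moreover have "(k + m = d) = (m = k - 1)" "k - 1 \<noteq> k" "k + 1 \<noteq> k" using k d by auto
          ultimately show ?thesis using pos unfolding p_moment_def d[symmetric] by simp
        next
          case 3
          moreover from this have "i + 1 \<noteq> k" by auto
          ultimately show ?thesis unfolding p_moment_def by simp
        qed
      qed
      finally show ?thesis .
    qed
    have "p_form k = ?F \<longleftrightarrow> (\<forall>i m. i + m = d \<longrightarrow> ?S i = p_moment k i)"
      unfolding poly_eq_iff F P by (auto simp: zero_less_binomial_iff)
    also have "\<dots> \<longleftrightarrow> ?R" by (metis le_add1 le_add_diff_inverse)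
    finally show ?thesis .
  qed
  then show ?thesis unfolding has_power_sum_rep_def by simp
qed

lemma form_length_eqI:
  assumes "has_power_sum_rep K d f r" "\<And>s. s < r \<Longrightarrow> \<not> has_power_sum_rep K d f s"
  shows "form_length K d f = enat r"
  unfolding form_length_def
proof (rule antisym)
  show "(INF r\<in>{r. has_power_sum_rep K d f r}. enat r) \<le> enat r"
    by (rule INF_lower) (use assms(1) in simp)
  show "enat r \<le> (INF r\<in>{r. has_power_sum_rep K d f r}. enat r)"
    by (rule INF_greatest) (use assms(2) in \<open>force simp: not_less[symmetric]\<close>)
qed

subsection \<open>Lower bounds\<close>

lemma poly_eq_sum_degree_le:
  fixes x :: "'a::idom"
  shows "degree p \<le> n \<Longrightarrow> poly p x = (\<Sum>i\<le>n. coeff p i * x ^ i)"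
  unfolding poly_altdef by (rule sum.mono_neutral_left) (auto intro: coeff_eq_0)

text \<open>Sylvester's apolarity: the points \<open>\<beta>\<^sub>j / \<alpha>\<^sub>j\<close> of a representation are roots of a polynomial
  annihilating the moment sequence. A point at infinity (\<open>\<alpha>\<^sub>j = 0\<close>) costs one of the relations.\<close>

lemma moments_annihilated:
  fixes c \<alpha> \<beta> :: "nat \<Rightarrow> 'a::field"
  assumes a: "\<forall>i\<le>d. (\<Sum>j=1..r. c j * \<alpha> j ^ (d - i) * \<beta> j ^ i) = a i"
    and B: "B = (\<lambda>j. \<beta> j / \<alpha> j) ` {j \<in> {1..r}. \<alpha> j \<noteq> 0}"
    and q: "degree q \<le> card B" "\<forall>b\<in>B. poly q b = 0"
    and l: "l + r \<le> d \<or> l + card B < d"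
  shows "(\<Sum>t\<le>card B. coeff q t * a (l + t)) = 0"
proof -
  let ?J = "{j \<in> {1..r}. \<alpha> j \<noteq> 0}"
  have card_B: "card B \<le> card ?J" unfolding B by (rule card_image_le) simp
  also have card_J: "card ?J \<le> r"
  proof -
    have "card ?J \<le> card {1..r}" by (rule card_mono) auto
    then show ?thesis by simp
  qed
  finally have l': "l + card B \<le> d" using l by linarith
  have zero: "(\<Sum>t\<le>card B. coeff q t * (\<alpha> j ^ (d - (l + t)) * \<beta> j ^ (l + t))) = 0" if j: "j \<in> {1..r}" for j
  proof (cases "\<alpha> j = 0")
    case True
    \<comment> \<open>A point at infinity makes \<open>card B < r\<close>, so under either
      alternative for \<open>l\<close> the exponent of \<open>\<alpha> j = 0\<close> is positive in
      every term.\<close>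
    have "?J \<subset> {1..r}" using True j by blast
    then have "card ?J < r" using psubset_card_mono[of "{1..r}" ?J] by simp
    then have "l + card B < d" using l card_B by linarith
    then show ?thesis using True by (intro sum.neutral) auto
  next
    case False
    define b where "b = \<beta> j / \<alpha> j"
    have \<beta>: "\<beta> j = \<alpha> j * b" using False by (simp add: b_def)
    have "b \<in> B" using False j unfolding B b_def by auto
    have "\<alpha> j ^ (d - (l + t)) * \<beta> j ^ (l + t) = \<alpha> j ^ d * b ^ l * b ^ t" if "t \<le> card B" for t
    proof -
      have "d - (l + t) + (l + t) = d" using l' that by simp
      then have "\<alpha> j ^ d = \<alpha> j ^ (d - (l + t)) * \<alpha> j ^ (l + t)" by (metis power_add)
      then show ?thesis unfolding \<beta> power_mult_distrib by (simp add: power_add)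
    qed
    then have "(\<Sum>t\<le>card B. coeff q t * (\<alpha> j ^ (d - (l + t)) * \<beta> j ^ (l + t)))
        = \<alpha> j ^ d * b ^ l * (\<Sum>t\<le>card B. coeff q t * b ^ t)"
      by (simp add: sum_distrib_left mult_ac)
    also have "(\<Sum>t\<le>card B. coeff q t * b ^ t) = poly q b"
      by (rule poly_eq_sum_degree_le[OF q(1), symmetric])
    finally show ?thesis using q(2) \<open>b \<in> B\<close> by simp
  qed
  have "(\<Sum>t\<le>card B. coeff q t * a (l + t))
      = (\<Sum>t\<le>card B. coeff q t * (\<Sum>j=1..r. c j * \<alpha> j ^ (d - (l + t)) * \<beta> j ^ (l + t)))"
    using a l' by (intro sum.cong) auto
  also have "\<dots> = (\<Sum>j=1..r. c j * (\<Sum>t\<le>card B. coeff q t * (\<alpha> j ^ (d - (l + t)) * \<beta> j ^ (l + t))))"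
    unfolding sum_distrib_left by (subst sum.swap) (simp add: mult_ac)
  also have "\<dots> = 0" using zero by (intro sum.neutral) auto
  finally show ?thesis .
qed

text \<open>The moments vanish except for opposite values at \<open>k - 1\<close> and
  \<open>k\<close>, so annihilation at shift \<open>l\<close> compares two neighbouring
  coefficients. \<open>B\<close> collects the finite points; it can have fewer than \<open>r\<close>
  elements, since points may coincide or lie at infinity, and the second alternative for
  \<open>l\<close> exploits this.\<close>

lemma p_form_rep_apolar:
  assumes rep: "has_power_sum_rep K (2 * k - 1) (p_form k) r" and k: "k \<ge> 1"
    and K: "\<forall>x\<in>K. \<forall>y\<in>K. x / y \<in> K"
  shows "\<exists>B. finite B \<and> B \<subseteq> K \<and> card B \<le> r \<and>
    (\<forall>q l. degree q \<le> card B \<longrightarrow> (\<forall>b\<in>B. poly q b = 0) \<longrightarrow> l < k \<longrightarrow>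
      l + r \<le> 2 * k - 1 \<or> l + card B < 2 * k - 1 \<longrightarrow> coeff q (k - 1 - l) = coeff q (k - l))"
proof -
  obtain c \<alpha> \<beta> where mem: "\<forall>j\<in>{1..r}. c j \<in> K \<and> \<alpha> j \<in> K \<and> \<beta> j \<in> K"
    and m: "\<forall>i\<le>2 * k - 1. (\<Sum>j=1..r. c j * \<alpha> j ^ (2 * k - 1 - i) * \<beta> j ^ i) = p_moment k i"
    using rep unfolding has_power_sum_rep_p_form_iff[OF k refl] by blast
  define B where "B = (\<lambda>j. \<beta> j / \<alpha> j) ` {j \<in> {1..r}. \<alpha> j \<noteq> 0}"
  show ?thesis
  proof (intro exI[of _ B] conjI allI impI)
    show "finite B" unfolding B_def by simp
    show "B \<subseteq> K" unfolding B_def using mem K by auto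
    have "card B \<le> card {j \<in> {1..r}. \<alpha> j \<noteq> 0}" unfolding B_def by (rule card_image_le) simp
    also have "\<dots> \<le> card {1..r}" by (rule card_mono) auto
    finally show "card B \<le> r" by simp
    fix q l
    assume q: "degree q \<le> card B" "\<forall>b\<in>B. poly q b = 0" and l: "l < k"
      "l + r \<le> 2 * k - 1 \<or> l + card B < 2 * k - 1"
    let ?C = "of_nat ((2 * k - 1) choose k) :: complex"
    have C: "?C \<noteq> 0" using k by simp
    have pick: "(\<Sum>t\<le>card B. coeff q t * of_bool (t = e)) = coeff q e" for e
    proof (cases "e \<le> card B")
      case False
      then have "coeff q e = 0" using q(1) by (intro coeff_eq_0) simp
      then show ?thesis using False by (simp add: of_bool_def if_distrib cong: if_cong)
    qed (simp add: of_bool_def if_distrib cong: if_cong)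
    have "0 = (\<Sum>t\<le>card B. coeff q t * p_moment k (l + t))"
      using moments_annihilated[OF m B_def q l(2)] by simp
    also have "\<dots> = (\<Sum>t\<le>card B. coeff q t * of_bool (t = k - 1 - l) - coeff q t * of_bool (t = k - l)) / ?C"
      unfolding sum_divide_distrib
    proof (rule sum.cong)
      fix t
      have "(l + t + 1 = k) = (t = k - 1 - l)" "(l + t = k) = (t = k - l)" using l(1) by auto
      then show "coeff q t * p_moment k (l + t)
        = (coeff q t * of_bool (t = k - 1 - l) - coeff q t * of_bool (t = k - l)) / ?C"
        unfolding p_moment_def by (simp add: right_diff_distrib)
    qed simp
    also have "\<dots> = (coeff q (k - 1 - l) - coeff q (k - l)) / ?C"
      unfolding sum_subtractf pick ..
    finally show "coeff q (k - 1 - l) = coeff q (k - l)" using C by simp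
  qed
qed

lemma all_coeffs_equal:
  assumes "\<And>l. l < k \<Longrightarrow> coeff q (k - 1 - l) = coeff q (k - l)" "i \<le> k"
  shows "coeff q i = coeff q k"
  using assms(2)
proof (induction i rule: inc_induct)
  case (step n)
  then show ?case using assms(1)[of "k - 1 - n"] by simp
qed simp

lemma degree_prod_linear:
  "finite B \<Longrightarrow> degree (\<Prod>b\<in>B. [:- b, 1 :: 'a::idom:]) = card B"
  by (subst degree_prod_eq_sum_degree) auto

lemma lead_coeff_prod_linear:
  "finite B \<Longrightarrow> coeff (\<Prod>b\<in>B. [:- b, 1 :: 'a::idom:]) (card B) = 1"
  using lead_coeff_prod[of "\<lambda>b. [:- b, 1 :: 'a:]" B] by (simp add: degree_prod_linear)

text \<open>For \<open>r \<le> k\<close> every shift \<open>l < k\<close> is permitted, so the monic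
  polynomial with root set \<open>B\<close> has equal coefficients up to \<open>k\<close>. It is
  \<open>1 + t + ... + t^k\<close>, whose roots are the \<open>(k + 1)\<close>-th roots of unity
  other than 1, and \<open>B \<subseteq> K\<close>.\<close>

lemma p_form_short_rep:
  assumes rep: "has_power_sum_rep K (2 * k - 1) (p_form k) r" and k: "k \<ge> 1" and r: "r \<le> k"
    and K: "\<forall>x\<in>K. \<forall>y\<in>K. x / y \<in> K"
  shows "r = k \<and> (\<forall>z. z ^ (k + 1) = 1 \<and> z \<noteq> 1 \<longrightarrow> z \<in> K)"
proof -
  obtain B where B: "finite B" "B \<subseteq> K" "card B \<le> r"
    and ap: "\<forall>q l. degree q \<le> card B \<longrightarrow> (\<forall>b\<in>B. poly q b = 0) \<longrightarrow> l < k \<longrightarrow>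
      l + r \<le> 2 * k - 1 \<or> l + card B < 2 * k - 1 \<longrightarrow> coeff q (k - 1 - l) = coeff q (k - l)"
    using p_form_rep_apolar[OF rep k K] by blast
  define q where "q = (\<Prod>b\<in>B. [:- b, 1:])"
  have q: "degree q = card B" "coeff q (card B) = 1" "\<forall>b\<in>B. poly q b = 0"
    unfolding q_def using B(1) degree_prod_linear lead_coeff_prod_linear by (auto simp: poly_prod)
  have eq: "coeff q i = coeff q k" if "i \<le> k" for i
    by (rule all_coeffs_equal[OF _ that], rule ap[rule_format]) (use q r in auto)
  \<comment> \<open>The leading coefficient sits at \<open>card B \<le> k\<close>, so the common
    value is 1 and the degree cannot be below \<open>k\<close>.\<close>
  have "coeff q k = 1" using eq[of "card B"] q(2) B(3) r by simp
  then have "k \<le> card B" using q(1) le_degree[of q k] by simp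
  then have deg: "card B = k" "r = k" using B(3) r by auto
  have "z \<in> K" if z: "z ^ (k + 1) = 1" "z \<noteq> 1" for z
  proof -
    have "poly q z = (\<Sum>i\<le>k. z ^ i)"
      unfolding poly_altdef q(1) deg using eq \<open>coeff q k = 1\<close> by simp
    also have "\<dots> = 0" using z sum_gp_strict[of z "Suc k"] by (simp add: lessThan_Suc_atMost)
    finally have "z \<in> B" unfolding q_def using B(1) by (simp add: poly_prod)
    then show ?thesis using B(2) by blast
  qed
  then show ?thesis using deg by blast
qed

section \<open>Real-rooted polynomials and the real lower bound\<close>

text \<open>Rolle's theorem, adding the roots in increasing order. The clause
  \<open>x < Max S\<close> carries the induction: the new critical point lies beyond the old
  maximum, hence differs from the earlier ones.\<close>

lemma roots_pderiv_between:
  fixes p :: "real poly"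
  assumes "finite S" "S \<noteq> {}" "\<forall>x\<in>S. poly p x = 0"
  shows "\<exists>T. finite T \<and> card T + 1 = card S \<and> (\<forall>x\<in>T. poly (pderiv p) x = 0 \<and> x < Max S)"
  using assms
proof (induction S rule: finite_linorder_max_induct)
  case (insert b A)
  show ?case
  proof (cases "A = {}")
    case True
    then show ?thesis by (intro exI[of _ "{}"]) auto
  next
    case False
    then obtain T where T: "finite T" "card T + 1 = card A"
      "\<forall>x\<in>T. poly (pderiv p) x = 0 \<and> x < Max A"
      using insert by auto
    have MA: "Max A \<in> A" using False insert.hyps(1) by simp
    then have "Max A < b" using insert.hyps by blast
    from poly_MVT[OF this, of p] obtain x where x: "Max A < x" "x < b"
      "poly p b - poly p (Max A) = (b - Max A) * poly (pderiv p) x" by auto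
    have "poly (pderiv p) x = 0" using x insert.prems MA by auto
    moreover have "x \<notin> T" using T(3) x(1) by force
    moreover have "Max (insert b A) = b"
      using insert.hyps by (intro Max_eqI) (auto intro: less_imp_le)
    moreover have "b \<notin> A" using insert.hyps by blast
    ultimately show ?thesis using T x insert.hyps(1)
      by (intro exI[of _ "insert x T"]) fastforce
  qed
qed simp

lemma higher_pderiv_real_rooted:
  fixes p :: "real poly"
  assumes "finite S" "\<forall>x\<in>S. poly p x = 0" "card S = degree p" "n \<le> degree p"
  shows "\<exists>T. finite T \<and> (\<forall>x\<in>T. poly ((pderiv ^^ n) p) x = 0)
    \<and> card T = degree ((pderiv ^^ n) p) \<and> degree ((pderiv ^^ n) p) = degree p - n"
  using assms(4)
proof (induction n)
  case 0
  then show ?case using assms by auto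
next
  case (Suc n)
  then obtain T where T: "finite T" "\<forall>x\<in>T. poly ((pderiv ^^ n) p) x = 0"
    "card T = degree ((pderiv ^^ n) p)" "degree ((pderiv ^^ n) p) = degree p - n" by auto
  have "card T > 0" using T Suc.prems by simp
  then have "T \<noteq> {}" by auto
  from roots_pderiv_between[OF T(1) this T(2)] obtain U where
    "finite U" "card U + 1 = card T" "\<forall>x\<in>U. poly (pderiv ((pderiv ^^ n) p)) x = 0" by blast
  then show ?case using T(3,4) by (intro exI[of _ U]) (simp add: degree_pderiv)
qed

text \<open>For \<open>p = (x - a) * g\<close> one has
  \<open>p'^2 - p * p'' = (x - a)^2 * (g'^2 - g * g'') + g^2\<close>. By induction this is positive
  for \<open>x \<noteq> a\<close>; at \<open>x = a\<close> simplicity of the roots gives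
  \<open>g(a) \<noteq> 0\<close>.\<close>

lemma laguerre_inequality:
  fixes p :: "real poly"
  assumes "finite S" "S \<noteq> {}" "\<forall>x\<in>S. poly p x = 0" "card S = degree p"
  shows "poly p x * poly (pderiv (pderiv p)) x < (poly (pderiv p) x)\<^sup>2"
  using assms
proof (induction S arbitrary: p rule: finite_ne_induct)
  case (singleton a)
  then have "pderiv p \<noteq> 0" "degree (pderiv p) = 0"
    by (auto simp: pderiv_eq_0_iff degree_pderiv)
  then obtain e where e: "pderiv p = [:e:]" "e \<noteq> 0" by (metis degree_eq_zeroE pCons_0_0)
  then show ?case by (simp add: pderiv_pCons)
next
  case (insert a S)
  obtain g where g: "p = [:- a, 1:] * g" using insert.prems(1) by (metis dvdE insertI1 poly_eq_0_iff_dvd)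
  have "p \<noteq> 0" using insert by auto
  then have "g \<noteq> 0" using g by auto
  then have "degree p = degree g + 1" unfolding g by (subst degree_mult_eq) auto
  then have deg: "card S = degree g" using insert by simp
  have roots: "\<forall>x\<in>S. poly g x = 0"
    using insert.prems(1) insert.hyps(3) unfolding g by auto
  have IH: "poly g x * poly (pderiv (pderiv g)) x < (poly (pderiv g) x)\<^sup>2"
    by (rule insert.IH[OF roots deg])
  have id: "(poly (pderiv p) x)\<^sup>2 - poly p x * poly (pderiv (pderiv p)) x
      = (x - a)\<^sup>2 * ((poly (pderiv g) x)\<^sup>2 - poly g x * poly (pderiv (pderiv g)) x) + (poly g x)\<^sup>2"
  proof -
    define L where "L = [:- a, 1:]"
    have L: "pderiv L = 1" "poly L x = x - a" by (simp_all add: L_def pderiv_pCons)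
    have "pderiv p = L * pderiv g + g" "pderiv (pderiv p) = L * pderiv (pderiv g) + 2 * pderiv g"
      unfolding g L_def[symmetric] by (simp_all add: pderiv_mult pderiv_add L)
    moreover have "p = L * g" unfolding g L_def ..
    ultimately show ?thesis by (simp add: L algebra_simps power2_eq_square)
  qed
  have "poly g a \<noteq> 0"
  proof
    assume "poly g a = 0"
    then have "insert a S \<subseteq> {x. poly g x = 0}" using roots by auto
    then have "card (insert a S) \<le> degree g"
      using poly_roots_degree[OF \<open>g \<noteq> 0\<close>] card_mono[OF poly_roots_finite[OF \<open>g \<noteq> 0\<close>]] le_trans by blast
    then show False using deg insert.hyps by simp
  qed
  then have "0 < (x - a)\<^sup>2 * ((poly (pderiv g) x)\<^sup>2 - poly g x * poly (pderiv (pderiv g)) x) + (poly g x)\<^sup>2"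
    using IH by (cases "x = a") (auto intro!: add_pos_nonneg)
  then show ?case using id by linarith
qed

text \<open>Differentiating \<open>n\<close> times moves the three coefficients to positions 0, 1,
  2. With common value \<open>c\<close>, Laguerre's inequality at 0 reads
  \<open>n! (n+2)! c^2 < ((n+1)!)^2 c^2\<close>, but
  \<open>((n+1)!)^2 \<le> n! (n+2)!\<close>.\<close>

lemma no_three_equal_coeffs:
  fixes p :: "real poly"
  assumes "finite S" "\<forall>x\<in>S. poly p x = 0" "card S = degree p" "n < degree p"
    and eq: "coeff p n = coeff p (n + 1)" "coeff p (n + 1) = coeff p (n + 2)"
  shows False
proof -
  let ?g = "(pderiv ^^ n) p"
  obtain T where T: "finite T" "\<forall>x\<in>T. poly ?g x = 0" "card T = degree ?g" "degree ?g = degree p - n"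
    using higher_pderiv_real_rooted[OF assms(1-3) less_imp_le[OF assms(4)]] by blast
  have "T \<noteq> {}" using T assms(4) by auto
  from laguerre_inequality[OF T(1) this T(2,3), of 0]
  have "coeff ?g 0 * (2 * coeff ?g 2) < (coeff ?g 1)\<^sup>2"
    by (simp add: poly_0_coeff_0 coeff_pderiv numeral_2_eq_2)
  moreover have p1: "pochhammer 1 n = (fact n :: real)"
    and p2: "pochhammer 2 n = (fact (Suc n) :: real)"
    and p3: "pochhammer 3 n = (fact (Suc (Suc n)) / 2 :: real)"
    unfolding pochhammer_fact pochhammer_rec by simp_all
  moreover define c where "c = coeff p n"
  have "coeff ?g 0 = fact n * c" "coeff ?g 1 = fact (n + 1) * c" "2 * coeff ?g 2 = fact (n + 2) * c"
    using eq by (simp_all add: coeff_higher_pderiv c_def p1 p2 p3)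
  ultimately have "fact n * fact (n + 2) * c\<^sup>2 < (fact (n + 1) :: real)\<^sup>2 * c\<^sup>2"
    by (simp add: power2_eq_square mult_ac)
  moreover have "(fact (n + 1))\<^sup>2 \<le> (fact n * fact (n + 2) :: real)"
    by (simp add: power2_eq_square algebra_simps)
  ultimately show False
    by (meson mult_right_mono not_less zero_le_power2)
qed

lemma p_form_real_rep:
  assumes rep: "has_power_sum_rep \<real> (2 * k - 1) (p_form k) r" and k: "k \<ge> 2"
  shows "2 * k - 1 \<le> r"
proof (rule ccontr)
  assume r: "\<not> 2 * k - 1 \<le> r"
  have k1: "k \<ge> 1" using k by simp
  have div: "\<forall>x\<in>\<real>. \<forall>y\<in>\<real>. x / y \<in> (\<real> :: complex set)" by auto
  obtain B :: "complex set" where B: "finite B" "B \<subseteq> \<real>" "card B \<le> r"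
    and ap: "\<forall>q l. degree q \<le> card B \<longrightarrow> (\<forall>b\<in>B. poly q b = 0) \<longrightarrow> l < k \<longrightarrow>
      l + r \<le> 2 * k - 1 \<or> l + card B < 2 * k - 1 \<longrightarrow> coeff q (k - 1 - l) = coeff q (k - l)"
    using p_form_rep_apolar[OF rep k1 div] by blast
  define S where "S = Re ` B"
  have "inj_on Re B"
    using B(2) by (intro inj_onI) (metis of_real_Re subsetD)
  then have card: "card S = card B" unfolding S_def by (rule card_image)
  have S: "finite S" using B(1) unfolding S_def by simp
  have BS: "\<exists>x\<in>S. b = of_real x" if "b \<in> B" for b
    using that B(2) unfolding S_def by (metis image_eqI of_real_Re subsetD)
  define p where "p = (\<Prod>x\<in>S. [:- x, 1:])"
  have p: "degree p = card S" "coeff p (card S) = 1" "\<forall>x\<in>S. poly p x = 0"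
    unfolding p_def using S degree_prod_linear lead_coeff_prod_linear by (auto simp: poly_prod)
  define q :: "complex poly" where "q = map_poly of_real p"
  have q: "degree q \<le> card B" "\<forall>b\<in>B. poly q b = 0"
  proof -
    have "poly q (of_real x) = of_real (poly p x)" for x
      by (simp add: q_def poly_altdef degree_map_poly coeff_map_poly)
    then show "\<forall>b\<in>B. poly q b = 0" using BS p(3) by fastforce
  qed (simp add: q_def degree_map_poly p(1) card)
  have rel: "coeff p (k - 1 - l) = coeff p (k - l)"
    if "l < k" "l + r \<le> 2 * k - 1 \<or> l + card B < 2 * k - 1" for l
    using ap[rule_format, OF q(1) _ that] q(2) by (simp add: q_def coeff_map_poly)
  \<comment> \<open>With fewer than \<open>k - 1\<close> finite points the second alternative
    permits all shifts, so the leading coefficient 1 would equal the vanishing coefficient at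
    \<open>k\<close>.\<close>
  have "k - 1 \<le> card B"
  proof (rule ccontr)
    assume neg: "\<not> k - 1 \<le> card B"
    have "coeff p i = coeff p k" if "i \<le> k" for i
      by (rule all_coeffs_equal[OF rel that]) (use neg in auto)
    moreover have "coeff p k = 0" using p(1) neg card by (intro coeff_eq_0) simp
    ultimately have "coeff p (card S) = 0" using card neg by simp
    then show False using p(2) by simp
  qed
  then have "k - 2 < degree p" using p(1) card k by simp
  \<comment> \<open>Shift 1 is permitted exactly because
    \<open>1 + r \<le> 2 * k - 1\<close>.\<close>
  moreover have "coeff p (k - 1) = coeff p k" "coeff p (k - 2) = coeff p (k - 1)"
    using rel[of 0] rel[of 1] r k by (auto simp: numeral_2_eq_2)
  moreover have "k - 2 + 1 = k - 1" "k - 2 + 2 = k" using k by auto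
  ultimately show False
    using no_three_equal_coeffs[OF S p(3) p(1)[symmetric], of "k - 2"] by simp
qed

subsection \<open>Upper bounds\<close>

lemma rat_adjoin_rat: "q \<in> \<rat> \<Longrightarrow> q \<in> rat_adjoin z"
  and rat_adjoin_self: "z \<in> rat_adjoin z"
  unfolding rat_adjoin_def by (auto intro: generate_field.incl)

lemma rat_adjoin_add: "x \<in> rat_adjoin z \<Longrightarrow> y \<in> rat_adjoin z \<Longrightarrow> x + y \<in> rat_adjoin z"
  unfolding rat_adjoin_def
  using generate_field.eng_add[of x ring_of_type_algebra _ y] by (simp add: ring_of_type_algebra_def)

lemma rat_adjoin_mult: "x \<in> rat_adjoin z \<Longrightarrow> y \<in> rat_adjoin z \<Longrightarrow> x * y \<in> rat_adjoin z"
  unfolding rat_adjoin_def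
  using generate_field.eng_mult[of x ring_of_type_algebra _ y] by (simp add: ring_of_type_algebra_def)

lemma rat_adjoin_diff: "x \<in> rat_adjoin z \<Longrightarrow> y \<in> rat_adjoin z \<Longrightarrow> x - y \<in> rat_adjoin z"
  using rat_adjoin_add[of x z "-1 * y"] rat_adjoin_mult[OF rat_adjoin_rat, of "-1"] by simp

lemma rat_adjoin_power: "x \<in> rat_adjoin z \<Longrightarrow> x ^ n \<in> rat_adjoin z"
  by (induction n) (auto intro: rat_adjoin_rat rat_adjoin_mult)

lemma rat_adjoin_inverse:
  assumes "x \<in> rat_adjoin z"
  shows "inverse x \<in> rat_adjoin z"
proof (cases "x = 0")
  case False
  interpret R: field "ring_of_type_algebra :: complex ring"
    by (rule field_from_type_algebra)
  have "inv\<^bsub>ring_of_type_algebra\<^esub> x = inverse x"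
    by (rule R.comm_inv_char) (use False in \<open>simp_all add: ring_of_type_algebra_def\<close>)
  moreover have "x \<noteq> \<zero>\<^bsub>ring_of_type_algebra\<^esub>" using False by (simp add: ring_of_type_algebra_def)
  ultimately show ?thesis
    using generate_field.m_inv[of x ring_of_type_algebra] assms unfolding rat_adjoin_def by simp
qed (simp add: rat_adjoin_rat)

lemma rat_adjoin_divide: "x \<in> rat_adjoin z \<Longrightarrow> y \<in> rat_adjoin z \<Longrightarrow> x / y \<in> rat_adjoin z"
  unfolding divide_inverse by (intro rat_adjoin_mult rat_adjoin_inverse)

text \<open>Orthogonality of characters: a geometric sum whose ratio \<open>z^e\<close> differs from
  1 by primitivity unless \<open>m\<close> divides \<open>e\<close>.\<close>

lemma sum_powers_primitive_root:
  assumes "primitive_root_of_unity m z"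
  shows "(\<Sum>j<m. z ^ (j * e)) = of_nat m * of_bool (m dvd e)"
proof -
  have m: "m > 0" "z ^ m = 1" and prim: "\<And>j. 0 < j \<Longrightarrow> j < m \<Longrightarrow> z ^ j \<noteq> 1"
    using assms unfolding primitive_root_of_unity_def by auto
  have S: "(\<Sum>j<m. z ^ (j * e)) = (\<Sum>j<m. (z ^ e) ^ j)"
    by (simp add: power_mult[symmetric] mult.commute)
  show ?thesis
  proof (cases "m dvd e")
    case True
    then have "z ^ e = 1" using m(2) by (auto simp: power_mult elim!: dvdE)
    then show ?thesis unfolding S using True by simp
  next
    case False
    have "z ^ e = z ^ (m * (e div m) + e mod m)" by simp
    also have "\<dots> = z ^ (e mod m)" unfolding power_add power_mult m(2) by simp
    finally have "z ^ e \<noteq> 1" using prim[of "e mod m"] False m(1) by (simp add: dvd_eq_mod_eq_0)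
    moreover have "(z ^ e) ^ m = 1" by (metis m(2) mult.commute power_mult power_one)
    ultimately show ?thesis unfolding S using False by (simp add: sum_gp_strict)
  qed
qed

text \<open>The Fourier transform on the \<open>(k + 1)\<close>-th roots of unity of the periodised moment sequence;
  the weight at \<open>1\<close> vanishes.\<close>

lemma p_form_rep_Suc:
  assumes k: "k \<ge> 2" and z: "primitive_root_of_unity (k + 1) z"
  shows "has_power_sum_rep (rat_adjoin z) (2 * k - 1) (p_form k) k"
proof -
  define C :: complex where "C = of_nat ((2 * k - 1) choose k)"
  \<comment> \<open>Inverse transform with period \<open>k + 1\<close>: the moments at
    \<open>k - 1\<close> and \<open>k\<close> contribute the inverses of
    \<open>z^(j * (k - 1))\<close> and \<open>z^(j * k)\<close>, which are \<open>z^(2 * j)\<close>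
    and \<open>z^j\<close>.\<close>
  define c where "c = (\<lambda>j. (z ^ (2 * j) - z ^ j) / (of_nat (k + 1) * C))"
  have k1: "k \<ge> 1" using k by simp
  have nz: "(of_nat (k + 1) :: complex) \<noteq> 0" by (simp only: of_nat_eq_0_iff)
  show ?thesis
    unfolding has_power_sum_rep_p_form_iff[OF k1 refl]
  proof (rule exI[of _ c], rule exI[of _ "\<lambda>_. 1"], rule exI[of _ "\<lambda>j. z ^ j"],
      intro conjI ballI allI impI)
    fix j :: nat
    show "c j \<in> rat_adjoin z" unfolding c_def C_def
      by (intro rat_adjoin_divide rat_adjoin_diff rat_adjoin_power rat_adjoin_self rat_adjoin_mult)
        (simp_all add: rat_adjoin_rat)
    show "1 \<in> rat_adjoin z" "z ^ j \<in> rat_adjoin z"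
      by (auto intro: rat_adjoin_rat rat_adjoin_power rat_adjoin_self)
  next
    fix i assume i: "i \<le> 2 * k - 1"
    have "(\<Sum>j=1..k. c j * 1 ^ (2 * k - 1 - i) * (z ^ j) ^ i) = (\<Sum>j=1..k. c j * (z ^ j) ^ i)" by simp
    also have "\<dots> = (\<Sum>j<k + 1. c j * (z ^ j) ^ i)"
    proof (rule sum.mono_neutral_left)
      show "\<forall>j\<in>{..<k + 1} - {1..k}. c j * (z ^ j) ^ i = 0"
      proof
        fix j assume "j \<in> {..<k + 1} - {1..k}"
        then have "j = 0" by auto
        then show "c j * (z ^ j) ^ i = 0" by (simp add: c_def)
      qed
    qed auto
    also have "\<dots> = (\<Sum>j<k + 1. (z ^ (j * (i + 2)) - z ^ (j * (i + 1))) / (of_nat (k + 1) * C))"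
    proof (rule sum.cong)
      fix j
      have "2 * j + j * i = j * (i + 2)" "j + j * i = j * (i + 1)" by simp_all
      then have "z ^ (2 * j) * (z ^ j) ^ i = z ^ (j * (i + 2))" "z ^ j * (z ^ j) ^ i = z ^ (j * (i + 1))"
        by (simp_all only: power_mult[symmetric] power_add[symmetric])
      then show "c j * (z ^ j) ^ i = (z ^ (j * (i + 2)) - z ^ (j * (i + 1))) / (of_nat (k + 1) * C)"
        unfolding c_def by (simp only: times_divide_eq_left left_diff_distrib)
    qed simp
    also have "\<dots> = ((\<Sum>j<k + 1. z ^ (j * (i + 2))) - (\<Sum>j<k + 1. z ^ (j * (i + 1)))) / (of_nat (k + 1) * C)"
      unfolding sum_divide_distrib sum_subtractf[symmetric] ..
    also have "\<dots> = (of_nat (k + 1) * (of_bool (k + 1 dvd i + 2) - of_bool (k + 1 dvd i + 1))) / (of_nat (k + 1) * C)"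
      unfolding sum_powers_primitive_root[OF z] right_diff_distrib ..
    also have "\<dots> = (of_bool (k + 1 dvd i + 2) - of_bool (k + 1 dvd i + 1)) / C"
      by (rule mult_divide_mult_cancel_left[OF nz])
    \<comment> \<open>Since \<open>i + 2 < 2 * (k + 1)\<close>, the only positive multiple of
      \<open>k + 1\<close> in range is \<open>k + 1\<close> itself.\<close>
    also have "(k + 1 dvd i + 2) = (i + 1 = k)"
    proof
      assume "k + 1 dvd i + 2"
      then obtain t where t: "i + 2 = (k + 1) * t" by (elim dvdE)
      have "t < 2"
      proof (rule ccontr)
        assume "\<not> t < 2"
        then have "(k + 1) * 2 \<le> (k + 1) * t" by (intro mult_le_mono2) simp
        then show False unfolding t[symmetric] using i k by simp
      qed
      moreover have "t \<noteq> 0" using t by (cases t) auto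
      ultimately have "t = 1" by simp
      then show "i + 1 = k" using t by simp
    qed auto
    also have "(k + 1 dvd i + 1) = (i = k)"
    proof
      assume "k + 1 dvd i + 1"
      then obtain t where t: "i + 1 = (k + 1) * t" by (elim dvdE)
      have "t < 2"
      proof (rule ccontr)
        assume "\<not> t < 2"
        then have "(k + 1) * 2 \<le> (k + 1) * t" by (intro mult_le_mono2) simp
        then show False unfolding t[symmetric] using i k by simp
      qed
      moreover have "t \<noteq> 0" using t by (cases t) auto
      ultimately have "t = 1" by simp
      then show "i = k" using t by simp
    qed auto
    finally show "(\<Sum>j=1..k. c j * 1 ^ (2 * k - 1 - i) * (z ^ j) ^ i) = p_moment k i"
      unfolding p_moment_def C_def .
  qed
qed

text \<open>The same on the \<open>k\<close>-th roots of unity. Here the periodised sequence has the two spurious values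
  \<open>-1\<close> at \<open>0\<close> and \<open>1\<close> at \<open>2k - 1\<close>, which \<open>x\<^sup>2\<^sup>k\<^sup>-\<^sup>1\<close> and \<open>-y\<^sup>2\<^sup>k\<^sup>-\<^sup>1\<close> correct.\<close>

lemma p_form_rep_adjoin:
  assumes k: "k \<ge> 2" and z: "primitive_root_of_unity k z"
  shows "has_power_sum_rep (rat_adjoin z) (2 * k - 1) (p_form k) (k + 1)"
proof -
  define C :: complex where "C = of_nat ((2 * k - 1) choose k)"
  \<comment> \<open>With period \<open>k\<close> the inverse characters become \<open>z^j\<close>
    and 1. The weight at \<open>j = 0\<close> vanishes, leaving \<open>k - 1\<close> roots of unity;
    indices \<open>k\<close> and \<open>k + 1\<close> carry the corrections at (1, 0) and (0,
    1).\<close>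
  define c where "c = (\<lambda>j. if j < k then (z ^ j - 1) / (of_nat k * C) else if j = k then 1 / C else -1 / C)"
  define \<alpha> :: "nat \<Rightarrow> complex" where "\<alpha> = (\<lambda>j. if j \<le> k then 1 else 0)"
  define \<beta> where "\<beta> = (\<lambda>j. if j < k then z ^ j else if j = k then 0 else 1)"
  have k1: "k \<ge> 1" using k by simp
  have nz: "(of_nat k :: complex) \<noteq> 0" using k by simp
  show ?thesis
    unfolding has_power_sum_rep_p_form_iff[OF k1 refl]
  proof (rule exI[of _ c], rule exI[of _ \<alpha>], rule exI[of _ \<beta>], intro conjI ballI allI impI)
    fix j
    have "(z ^ j - 1) / (of_nat k * C) \<in> rat_adjoin z" unfolding C_def
      by (intro rat_adjoin_divide rat_adjoin_diff rat_adjoin_power rat_adjoin_self rat_adjoin_mult)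
        (simp_all add: rat_adjoin_rat)
    then show "c j \<in> rat_adjoin z" unfolding c_def C_def by (auto intro: rat_adjoin_rat)
    show "\<alpha> j \<in> rat_adjoin z" "\<beta> j \<in> rat_adjoin z"
      by (auto simp: \<alpha>_def \<beta>_def intro: rat_adjoin_rat rat_adjoin_power rat_adjoin_self)
  next
    fix i assume i: "i \<le> 2 * k - 1"
    let ?f = "\<lambda>j. c j * \<alpha> j ^ (2 * k - 1 - i) * \<beta> j ^ i"
    have "{1..k + 1} = insert k (insert (k + 1) {1..<k})" using k by auto
    then have "sum ?f {1..k + 1} = ?f k + (?f (k + 1) + sum ?f {1..<k})" by simp
    \<comment> \<open>As \<open>0^0 = 1\<close>, the point (1, 0) contributes only to the first
      moment, and likewise (0, 1) only to the last.\<close>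
    also have "?f k = of_bool (i = 0) / C" by (simp add: c_def \<alpha>_def \<beta>_def power_0_left)
    also have "?f (k + 1) = - of_bool (i = 2 * k - 1) / C"
    proof -
      have "(0 :: complex) ^ (2 * k - 1 - i) = of_bool (i = 2 * k - 1)"
        using i by (auto simp: power_0_left)
      then show ?thesis by (simp add: c_def \<alpha>_def \<beta>_def)
    qed
    also have "sum ?f {1..<k} = (\<Sum>j<k. (z ^ j - 1) / (of_nat k * C) * (z ^ j) ^ i)"
    proof (rule sum.mono_neutral_cong_left)
      show "\<forall>j\<in>{..<k} - {1..<k}. (z ^ j - 1) / (of_nat k * C) * (z ^ j) ^ i = 0"
      proof
        fix j assume "j \<in> {..<k} - {1..<k}"
        then have "j = 0" by auto
        then show "(z ^ j - 1) / (of_nat k * C) * (z ^ j) ^ i = 0" by simp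
      qed
    qed (auto simp: c_def \<alpha>_def \<beta>_def)
    also have "\<dots> = (\<Sum>j<k. (z ^ (j * (i + 1)) - z ^ (j * i)) / (of_nat k * C))"
    proof (rule sum.cong)
      fix j
      have "z ^ j * (z ^ j) ^ i = z ^ (j * (i + 1))" "(z ^ j) ^ i = z ^ (j * i)"
        unfolding power_mult[symmetric] power_add[symmetric] by (simp_all add: algebra_simps)
      then show "(z ^ j - 1) / (of_nat k * C) * (z ^ j) ^ i = (z ^ (j * (i + 1)) - z ^ (j * i)) / (of_nat k * C)"
        by (simp only: times_divide_eq_left left_diff_distrib mult_1)
    qed simp
    also have "\<dots> = ((\<Sum>j<k. z ^ (j * (i + 1))) - (\<Sum>j<k. z ^ (j * i))) / (of_nat k * C)"
      unfolding sum_divide_distrib sum_subtractf[symmetric] ..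
    also have "\<dots> = (of_nat k * (of_bool (k dvd i + 1) - of_bool (k dvd i))) / (of_nat k * C)"
      unfolding sum_powers_primitive_root[OF z] right_diff_distrib ..
    also have "\<dots> = (of_bool (k dvd i + 1) - of_bool (k dvd i)) / C"
      by (rule mult_divide_mult_cancel_left[OF nz])
    also have "(k dvd i + 1) = (i + 1 = k \<or> i = 2 * k - 1)"
    proof
      assume "k dvd i + 1"
      then obtain t where t: "i + 1 = k * t" by (elim dvdE)
      have "t \<noteq> 0" using t by (cases t) auto
      moreover have "t < 3"
      proof (rule ccontr)
        assume "\<not> t < 3"
        then have "k * 3 \<le> k * t" by (intro mult_le_mono2) simp
        then show False using t i k by linarith
      qed
      ultimately have "t = 1 \<or> t = 2" by auto
      then show "i + 1 = k \<or> i = 2 * k - 1" using t by auto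
    next
      assume "i + 1 = k \<or> i = 2 * k - 1"
      then have "i + 1 = k \<or> i + 1 = 2 * k" using k by auto
      then show "k dvd i + 1" by auto
    qed
    also have "(k dvd i) = (i = 0 \<or> i = k)"
    proof
      assume "k dvd i"
      then obtain t where t: "i = k * t" by (elim dvdE)
      have "t < 2"
      proof (rule ccontr)
        assume "\<not> t < 2"
        then have "k * 2 \<le> k * t" by (intro mult_le_mono2) simp
        then show False using t i k by linarith
      qed
      then have "t = 0 \<or> t = 1" by auto
      then show "i = 0 \<or> i = k" using t by auto
    qed auto
    also have "of_bool (i = 0) / C + (- of_bool (i = 2 * k - 1) / C +
        (of_bool (i + 1 = k \<or> i = 2 * k - 1) - of_bool (i = 0 \<or> i = k)) / C)
      = (of_bool (i + 1 = k) - of_bool (i = k)) / C"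
    proof -
      have "(of_bool (i + 1 = k \<or> i = 2 * k - 1) :: complex) = of_bool (i + 1 = k) + of_bool (i = 2 * k - 1)"
        using k by (auto simp: of_bool_def)
      moreover have "(of_bool (i = 0 \<or> i = k) :: complex) = of_bool (i = 0) + of_bool (i = k)"
        using k by (auto simp: of_bool_def)
      ultimately show ?thesis by (simp add: add_divide_distrib diff_divide_distrib)
    qed
    finally show "sum ?f {1..k + 1} = p_moment k i" unfolding p_moment_def C_def .
  qed
qed

section \<open>The real representation\<close>

text \<open>Passing from \<open>a i\<close> to \<open>a (Suc i) - b * a i\<close> kills the node
  \<open>b\<close> and multiplies the weight at \<open>x\<close> by \<open>x - b\<close>. So the
  smaller system is solved for the differenced sequence, its weights are divided by
  \<open>x - b\<close>, and the weight at \<open>b\<close> is chosen to match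
  \<open>a 0\<close>.\<close>

lemma vandermonde_solution:
  fixes B :: "'a::field set" and a :: "nat \<Rightarrow> 'a"
  assumes "finite B"
  shows "\<exists>\<mu>. \<forall>i<card B. (\<Sum>x\<in>B. \<mu> x * x ^ i) = a i"
  using assms
proof (induction B arbitrary: a)
  case (insert b B)
  obtain \<mu> where \<mu>: "\<forall>i<card B. (\<Sum>x\<in>B. \<mu> x * x ^ i) = a (Suc i) - b * a i"
    using insert.IH[of "\<lambda>i. a (Suc i) - b * a i"] by blast
  define \<nu> where "\<nu> = (\<lambda>x. \<mu> x / (x - b))"
  define \<nu>' where "\<nu>' = \<nu>(b := a 0 - sum \<nu> B)"
  have sum_eq: "(\<Sum>x\<in>insert b B. \<nu>' x * x ^ i) = (a 0 - sum \<nu> B) * b ^ i + (\<Sum>x\<in>B. \<nu> x * x ^ i)" for i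
  proof -
    have "(\<Sum>x\<in>B. \<nu>' x * x ^ i) = (\<Sum>x\<in>B. \<nu> x * x ^ i)"
      using insert.hyps by (intro sum.cong) (auto simp: \<nu>'_def)
    then show ?thesis using insert.hyps by (simp add: \<nu>'_def)
  qed
  have "(\<Sum>x\<in>insert b B. \<nu>' x * x ^ i) = a i" if "i < card (insert b B)" for i
    using that
  proof (induction i)
    case 0
    then show ?case unfolding sum_eq by simp
  next
    case (Suc i)
    have i: "i < card B" using Suc.prems insert.hyps by simp
    have "(\<Sum>x\<in>B. \<mu> x * x ^ i) = (\<Sum>x\<in>B. \<nu> x * x ^ Suc i - b * (\<nu> x * x ^ i))"
    proof (rule sum.cong)
      fix x assume "x \<in> B"
      then have "x - b \<noteq> 0" using insert.hyps by auto
      then have "\<mu> x = \<nu> x * (x - b)" unfolding \<nu>_def by simp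
      show "\<mu> x * x ^ i = \<nu> x * x ^ Suc i - b * (\<nu> x * x ^ i)"
        unfolding \<open>\<mu> x = \<nu> x * (x - b)\<close> by (simp add: algebra_simps)
    qed simp
    then have "(\<Sum>x\<in>B. \<nu> x * x ^ Suc i) = a (Suc i) - b * a i + b * (\<Sum>x\<in>B. \<nu> x * x ^ i)"
      using \<mu> i by (simp add: sum_subtractf sum_distrib_left)
    moreover have "(a 0 - sum \<nu> B) * b ^ i + (\<Sum>x\<in>B. \<nu> x * x ^ i) = a i"
      using Suc unfolding sum_eq by simp
    then have "(a 0 - sum \<nu> B) * b ^ i = a i - (\<Sum>x\<in>B. \<nu> x * x ^ i)"
      by (simp only: eq_diff_eq)
    then have "(a 0 - sum \<nu> B) * b ^ Suc i = b * (a i - (\<Sum>x\<in>B. \<nu> x * x ^ i))"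
      by (simp only: power_Suc mult.left_commute)
    ultimately show ?case unfolding sum_eq by (simp only: right_diff_distrib) simp
  qed
  then show ?case by blast
qed simp

text \<open>Each factor \<open>(t - i) * (t - 1/i)\<close>, like \<open>t + 1\<close>, equals its
  own reversal, so \<open>h\<close> is palindromic; in odd degree \<open>2 * k - 1\<close> the
  coefficients at \<open>k - 1\<close> and \<open>k\<close> are mirror images.\<close>

lemma palindromic_prod:
  fixes k :: nat
  defines "h \<equiv> [:1, 1:] * (\<Prod>i\<in>{2..k}. [:- real i, 1:] * [:- (1 / real i), 1:])"
  assumes k: "k \<ge> 1"
  shows "degree h = 2 * k - 1" "coeff h (k - 1) = coeff h k"
proof -
  let ?g = "\<lambda>i. [:- real i, 1:] * [:- (1 / real i), 1:]"
  have g: "degree (?g i) = 2" for i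
    by (subst degree_mult_eq) auto
  have "degree (\<Prod>i\<in>{2..k}. ?g i) = (\<Sum>i\<in>{2..k}. degree (?g i))"
    by (rule degree_prod_eq_sum_degree) auto
  also have "\<dots> = 2 * (k - 1)" unfolding g by simp
  finally have deg: "degree (\<Prod>i\<in>{2..k}. ?g i) = 2 * (k - 1)" .
  have "(\<Prod>i\<in>{2..k}. ?g i) \<noteq> 0" by (subst prod_zero_iff) auto
  then show "degree h = 2 * k - 1"
    unfolding h_def using deg k by (subst degree_mult_eq) auto
  have "reflect_poly (?g i) = ?g i" if "i \<ge> 2" for i
    using that by (simp add: reflect_poly_def)
  moreover have "reflect_poly [:1, 1 :: real:] = [:1, 1:]" by (simp add: reflect_poly_def)
  ultimately have refl: "reflect_poly h = h"
    unfolding h_def reflect_poly_mult[of "[:1, 1:]"] reflect_poly_prod by (intro arg_cong2[of _ _ _ _ "(*)"] prod.cong) auto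
  have "coeff h k = coeff (reflect_poly h) k" unfolding refl ..
  also have "\<dots> = coeff h (k - 1)"
    unfolding coeff_reflect_poly \<open>degree h = 2 * k - 1\<close> using k by (auto simp: mult_2)
  finally show "coeff h (k - 1) = coeff h k" ..
qed

text \<open>Vandermonde fixes the moments below \<open>2 * k - 1\<close>. The last one is forced:
  \<open>h\<close> annihilates the power sums because it vanishes on \<open>B\<close>, annihilates
  the target moments because its middle coefficients agree, and has nonzero leading
  coefficient.\<close>

lemma p_form_rep_real:
  assumes k: "k \<ge> 1"
  shows "has_power_sum_rep \<real> (2 * k - 1) (p_form k) (2 * k - 1)"
proof -
  let ?d = "2 * k - 1"
  \<comment> \<open>The roots of the palindromic \<open>h\<close>: -1 and \<open>k - 1\<close>
    reciprocal pairs, all distinct.\<close>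
  define B :: "real set" where "B = insert (-1) (real ` {2..k} \<union> (\<lambda>i. 1 / real i) ` {2..k})"
  have fin: "finite B" unfolding B_def by simp
  have card: "card B = ?d"
  proof -
    have "card (real ` {2..k}) = k - 1" "card ((\<lambda>i. 1 / real i) ` {2..k}) = k - 1"
      by (auto simp: card_image inj_on_def)
    moreover have "real ` {2..k} \<inter> (\<lambda>i. 1 / real i) ` {2..k} = {}"
    proof -
      have "real i \<noteq> 1 / real j" if "i \<ge> 2" "j \<ge> 2" for i j
      proof
        assume "real i = 1 / real j"
        then have "real (i * j) = real 1" using that by (simp add: field_simps)
        then have "i * j = 1" by (simp only: of_nat_eq_iff)
        then show False using that by simp
      qed
      then show ?thesis by auto
    qed
    ultimately have "card (real ` {2..k} \<union> (\<lambda>i. 1 / real i) ` {2..k}) = (k - 1) + (k - 1)"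
      by (subst card_Un_disjoint) auto
    moreover have "-1 \<notin> real ` {2..k} \<union> (\<lambda>i. 1 / real i) ` {2..k}"
    proof -
      have "-1 \<noteq> real i" "-1 \<noteq> 1 / real i" for i
        using of_nat_0_le_iff[of i, where ?'a = real] divide_nonneg_nonneg[of 1 "real i"] by linarith+
      then show ?thesis by auto
    qed
    ultimately show ?thesis unfolding B_def using k by simp
  qed
  define h where "h = [:1, 1:] * (\<Prod>i\<in>{2..k}. [:- real i, 1:] * [:- (1 / real i), 1:])"
  have h: "degree h = ?d" "coeff h (k - 1) = coeff h k"
    unfolding h_def by (rule palindromic_prod[OF k])+
  have h_root: "poly h x = 0" if "x \<in> B" for x
  proof -
    have L: "poly ([:- a, 1:] * [:- b, 1:]) x = (x - a) * (x - b)" for a b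
      by (simp add: algebra_simps)
    have "poly h x = (1 + x) * (\<Prod>i\<in>{2..k}. (x - real i) * (x - 1 / real i))"
      unfolding h_def poly_mult[of "[:1, 1:]"] poly_prod L by simp
    moreover have "x = -1 \<or> (\<exists>i\<in>{2..k}. x = real i \<or> x = 1 / real i)"
      using that unfolding B_def by auto
    ultimately show ?thesis by auto
  qed
  obtain \<mu> where \<mu>: "\<forall>i<?d. (\<Sum>x\<in>B. \<mu> x * x ^ i) = p_moment k i"
    using vandermonde_solution[OF fin, of "p_moment k"] unfolding card by blast
  have all: "(\<Sum>x\<in>B. \<mu> x * x ^ i) = p_moment k i" if "i \<le> ?d" for i
  proof (cases "i = ?d")
    case True
    define e where "e = (\<lambda>i. (\<Sum>x\<in>B. \<mu> x * x ^ i) - p_moment k i)"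
    have "(\<Sum>t\<le>?d. coeff h t * (\<Sum>x\<in>B. \<mu> x * x ^ t)) = (\<Sum>x\<in>B. \<mu> x * (\<Sum>t\<le>?d. coeff h t * x ^ t))"
      unfolding sum_distrib_left by (subst sum.swap) (simp add: mult_ac)
    also have "\<dots> = (\<Sum>x\<in>B. \<mu> x * poly h x)"
      using poly_eq_sum_degree_le[of h ?d] h(1) by simp
    also have "\<dots> = 0" using h_root by (intro sum.neutral) simp
    finally have 1: "(\<Sum>t\<le>?d. coeff h t * (\<Sum>x\<in>B. \<mu> x * x ^ t)) = 0" .
    let ?C = "real ((2 * k - 1) choose k)"
    have "(\<Sum>t\<le>?d. coeff h t * p_moment k t)
        = (\<Sum>t\<le>?d. coeff h t * of_bool (t = k - 1) - coeff h t * of_bool (t = k)) / ?C"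
      unfolding sum_divide_distrib
    proof (rule sum.cong)
      fix t
      have "(t + 1 = k) = (t = k - 1)" using k by auto
      then show "coeff h t * p_moment k t = (coeff h t * of_bool (t = k - 1) - coeff h t * of_bool (t = k)) / ?C"
        unfolding p_moment_def by (simp add: right_diff_distrib)
    qed simp
    also have "\<dots> = (coeff h (k - 1) - coeff h k) / ?C"
      unfolding sum_subtractf using k by (simp add: of_bool_def if_distrib cong: if_cong)
    finally have 2: "(\<Sum>t\<le>?d. coeff h t * p_moment k t) = 0" using h(2) by simp
    have "(\<Sum>t\<le>?d. coeff h t * e t) = 0"
      unfolding e_def right_diff_distrib sum_subtractf 1 2 by simp
    moreover have "(\<Sum>t\<le>?d. coeff h t * e t) = coeff h ?d * e ?d"
    proof -
      have "(\<Sum>t\<le>?d. coeff h t * e t) = (\<Sum>t\<in>{?d}. coeff h t * e t)"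
        by (rule sum.mono_neutral_right) (use \<mu> in \<open>auto simp: e_def\<close>)
      then show ?thesis by simp
    qed
    moreover have "coeff h ?d \<noteq> 0"
    proof -
      have "h \<noteq> 0" using h(1) k by auto
      then show ?thesis using h(1) leading_coeff_0_iff[of h] by simp
    qed
    ultimately have "e ?d = 0" by simp
    then show ?thesis using True unfolding e_def by simp
  qed (use \<mu> that in simp)
  obtain g where g: "bij_betw g {1..?d} B"
    using ex_bij_betw_nat_finite_1[OF fin] unfolding card by blast
  show ?thesis
    unfolding has_power_sum_rep_p_form_iff[OF k refl]
  proof (rule exI[of _ "\<lambda>j. of_real (\<mu> (g j))"], rule exI[of _ "\<lambda>_. 1"],
      rule exI[of _ "\<lambda>j. of_real (g j)"], intro conjI ballI allI impI)
    fix i assume i: "i \<le> ?d"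
    have "(\<Sum>j=1..?d. \<mu> (g j) * g j ^ i) = (\<Sum>x\<in>B. \<mu> x * x ^ i)"
      by (rule sum.reindex_bij_betw[OF g])
    also have "\<dots> = p_moment k i" by (rule all[OF i])
    finally have "complex_of_real (\<Sum>j=1..?d. \<mu> (g j) * g j ^ i) = of_real (p_moment k i)" by simp
    then show "(\<Sum>j=1..?d. complex_of_real (\<mu> (g j)) * 1 ^ (?d - i) * complex_of_real (g j) ^ i) = p_moment k i"
      by (simp add: p_moment_def)
  qed auto
qed

section \<open>The three lengths\<close>

theorem mainTheorem2:
  fixes k :: nat and \<zeta> :: "nat \<Rightarrow> complex"
  assumes "k \<ge> 3"
    and "\<And>m. m > 0 \<Longrightarrow> primitive_root_of_unity m (\<zeta> m)"
  shows "form_length (rat_adjoin (\<zeta> (k + 1))) (2 * k - 1) (p_form k) = enat k \<and>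
    form_length (rat_adjoin (\<zeta> k)) (2 * k - 1) (p_form k) = enat (k + 1) \<and>
    form_length \<real> (2 * k - 1) (p_form k) = enat (2 * k - 1) \<and> 2 * k - 1 > k + 1"
proof (intro conjI)
  have k: "k \<ge> 1" "k \<ge> 2" using assms(1) by auto
  have prim: "primitive_root_of_unity (k + 1) (\<zeta> (k + 1))" "primitive_root_of_unity k (\<zeta> k)"
    using assms by auto
  have div: "\<forall>x\<in>rat_adjoin z. \<forall>y\<in>rat_adjoin z. x / y \<in> rat_adjoin z" for z
    by (auto intro: rat_adjoin_divide)
  show "form_length (rat_adjoin (\<zeta> (k + 1))) (2 * k - 1) (p_form k) = enat k"
  proof (rule form_length_eqI)
    fix s assume s: "s < k"
    show "\<not> has_power_sum_rep (rat_adjoin (\<zeta> (k + 1))) (2 * k - 1) (p_form k) s"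
      using p_form_short_rep[OF _ k(1) _ div] s by (metis less_imp_le less_irrefl)
  qed (rule p_form_rep_Suc[OF k(2) prim(1)])
  show "form_length (rat_adjoin (\<zeta> k)) (2 * k - 1) (p_form k) = enat (k + 1)"
  proof (rule form_length_eqI)
    fix s assume s: "s < k + 1"
    show "\<not> has_power_sum_rep (rat_adjoin (\<zeta> k)) (2 * k - 1) (p_form k) s"
    proof
      assume "has_power_sum_rep (rat_adjoin (\<zeta> k)) (2 * k - 1) (p_form k) s"
      \<comment> \<open>At most \<open>k\<close> summands would put \<open>\<zeta> (k + 1)\<close>
        into the field generated by \<open>\<zeta> k\<close>.\<close>
      from p_form_short_rep[OF this k(1) _ div] s
      have "\<And>z. z ^ (k + 1) = 1 \<Longrightarrow> z \<noteq> 1 \<Longrightarrow> z \<in> rat_adjoin (\<zeta> k)" by simp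
      moreover have "\<zeta> (k + 1) ^ (k + 1) = 1" "\<zeta> (k + 1) \<noteq> 1"
        using prim(1) k unfolding primitive_root_of_unity_def by (auto dest: spec[of _ 1])
      ultimately have "\<zeta> (k + 1) \<in> rat_adjoin (\<zeta> k)" by blast
      moreover have "\<zeta> k ^ k = 1" using prim(2) unfolding primitive_root_of_unity_def by simp
      ultimately show False using primitive_root_not_in_rat_adjoin[OF k(2) _ prim(1)] by blast
    qed
  qed (rule p_form_rep_adjoin[OF k(2) prim(2)])
  show "form_length \<real> (2 * k - 1) (p_form k) = enat (2 * k - 1)"
    using p_form_real_rep[OF _ k(2)] by (intro form_length_eqI p_form_rep_real k(1)) (meson not_less)
  show "2 * k - 1 > k + 1" using assms(1) by simp
qed

end
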